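(* Let $\mathcal{A}_{\mathrm{full}}$ be an optimal deterministic gradient algorithm and let $\mathcal{A}_{\mathrm{stoc}}$ be an optimal stochastic gradient algorithm (both in the sense defined in the context), and let $s\ge 1$, $K \geq 1$. For a sufficiently large dimension $d$ and $\mathcal{X}=\{x\in\mathbb{R}^d:\|x\|_2^2\le 1\}$, there exists a set of convex and smooth functions $f_i\in\mathcal{F}^{1,1}_{L_b}(\mathcal{X})$, $i=1,\dots,K$, with $\frac1K\sum_{i=1}^K f_i=f\in\mathcal{F}^{1,1}_{L_f}(\mathcal{X})$, such that $$\frac{\mathbb{E} f(x^s_{\mathcal{A}_{\mathrm{stoc}}})-f^\star}{f(x^s_{\mathcal{A}_{\mathrm{full}}})-f^\star}\;\ge\;\frac{c_0\,L_b}{K L_f}$$ for some positive constant $c_0$ which does not depend on $L_b$, $L_f$ and $K$.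
   Context: The problem being solved is the unregularized finite-sum minimization $f^\star=\min_{x\in\mathcal{X}} f(x)$, $f(x)=\frac1K\sum_{i=1}^K f_i(x)$; $x^\star\in\mathcal{X}$ denotes a minimizer and $x^0\in\mathcal{X}$ the initial point of an algorithm. $\mathcal{F}^{p,q}_L(\mathcal{X})$ is the class of convex functions on $\mathcal{X}$ which are $p$ times differentiable and whose $q$-th derivatives are $L$-Lipschitz continuous on $\mathcal{X}$; so $L_b$ is a Lipschitz constant of the gradients $\nabla f_i$ and $L_f$ a Lipschitz constant of the full gradient $\nabla f$. A deterministic gradient method (one which accesses $f$ through the full gradient $\nabla f$) $\mathcal{A}_{\mathrm{full}}$ is called optimal if for any $s\ge1$ its $s$-th iterate $x^s_{\mathcal{A}_{\mathrm{full}}}$ satisfies $$f(x^s_{\mathcal{A}_{\mathrm{full}}})-f^\star\le\frac{C_1L_f\|x^0-x^\star\|_2^2}{s^2}$$ for some positive constant $C_1$. A stochastic gradient method (a randomized algorithm which accesses $f$ through a stochastic gradient oracle returning individual gradients $\nabla f_i$) $\mathcal{A}_{\mathrm{stoc}}$ is called optimal if for any $s\ge1$ and $K\ge1$, after $s\cdot K$ stochastic gradient evaluations, its output $x^s_{\mathcal{A}_{\mathrm{stoc}}}$ satisfies $$\mathbb{E} f(x^s_{\mathcal{A}_{\mathrm{stoc}}})-f^\star\le\frac{C_2[f(x^0)-f^\star]}{s^2}+\frac{C_3L_b\|x^0-x^\star\|_2^2}{Ks^2}$$ for some positive constants $C_2,C_3$. The expectation is over the randomness of the algorithm.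
   Formalization: The formal theorem assumes L_b ≤ K·L_f, automatic when L_b is the least common Lipschitz constant of the ∇f_i; for arbitrary constants the claim fails, since a stochastic method may simulate the full method when L_b ≥ K·L_f and the ratio is then 1. *)

theory Defs
  imports "HOL-Probability.Probability" "HOL-Library.Poly_Mapping"
begin

section \<open>Euclidean spaces of varying dimension\<close>

text \<open>
  The dimension is quantified inside the statement and an algorithm is defined for every
  dimension, so all the spaces \<open>\<real>\<^sup>d\<close> are realised inside one inner product space:
  the finitely supported real sequences, with \<open>\<real>\<^sup>d\<close> being those supported on
  \<open>{0, \<dots>, d - 1}\<close>.
\<close>

instantiation poly_mapping :: (type, real_vector) real_vector
begin

definition scaleR_poly_mapping :: "real \<Rightarrow> ('a \<Rightarrow>\<^sub>0 'b) \<Rightarrow> ('a \<Rightarrow>\<^sub>0 'b)"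
  where "scaleR_poly_mapping r = Poly_Mapping.map (\<lambda>v. r *\<^sub>R v)"

lemma lookup_scaleR_poly_mapping [simp]:
  "Poly_Mapping.lookup (r *\<^sub>R (x :: 'a \<Rightarrow>\<^sub>0 'b)) k = r *\<^sub>R Poly_Mapping.lookup x k"
  unfolding scaleR_poly_mapping_def by (simp add: map.rep_eq when_def)

instance
proof
  fix x y :: "'a \<Rightarrow>\<^sub>0 'b" and r s :: real
  show "r *\<^sub>R (x + y) = r *\<^sub>R x + r *\<^sub>R y"
    by (rule poly_mapping_eqI) (simp add: lookup_add scaleR_add_right)
  show "(r + s) *\<^sub>R x = r *\<^sub>R x + s *\<^sub>R x"
    by (rule poly_mapping_eqI) (simp add: lookup_add scaleR_add_left)
  show "r *\<^sub>R s *\<^sub>R x = (r * s) *\<^sub>R x"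
    by (rule poly_mapping_eqI) simp
  show "1 *\<^sub>R x = x"
    by (rule poly_mapping_eqI) simp
qed

end

instantiation poly_mapping :: (type, real_inner) real_inner
begin

definition inner_poly_mapping :: "('a \<Rightarrow>\<^sub>0 'b) \<Rightarrow> ('a \<Rightarrow>\<^sub>0 'b) \<Rightarrow> real"
  where "inner_poly_mapping x y = (\<Sum>k\<in>Poly_Mapping.keys x.
           inner (Poly_Mapping.lookup x k) (Poly_Mapping.lookup y k))"

definition norm_poly_mapping :: "('a \<Rightarrow>\<^sub>0 'b) \<Rightarrow> real"
  where "norm_poly_mapping x = sqrt (inner x x)"

definition sgn_poly_mapping :: "('a \<Rightarrow>\<^sub>0 'b) \<Rightarrow> ('a \<Rightarrow>\<^sub>0 'b)"
  where "sgn_poly_mapping x = x /\<^sub>R norm x"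

definition dist_poly_mapping :: "('a \<Rightarrow>\<^sub>0 'b) \<Rightarrow> ('a \<Rightarrow>\<^sub>0 'b) \<Rightarrow> real"
  where "dist_poly_mapping x y = norm (x - y)"

definition uniformity_poly_mapping :: "(('a \<Rightarrow>\<^sub>0 'b) \<times> ('a \<Rightarrow>\<^sub>0 'b)) filter"
  where "uniformity_poly_mapping = (INF e\<in>{0<..}. principal {(x, y). dist x y < e})"

definition open_poly_mapping :: "('a \<Rightarrow>\<^sub>0 'b) set \<Rightarrow> bool"
  where "open_poly_mapping U \<longleftrightarrow> (\<forall>x\<in>U. eventually (\<lambda>(x', y). x' = x \<longrightarrow> y \<in> U) uniformity)"

lemma inner_poly_mapping_superset:
  fixes x y :: "'a \<Rightarrow>\<^sub>0 'b"
  assumes "finite A" "Poly_Mapping.keys x \<subseteq> A"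
  shows "inner x y = (\<Sum>k\<in>A. inner (Poly_Mapping.lookup x k) (Poly_Mapping.lookup y k))"
  unfolding inner_poly_mapping_def
  by (rule sum.mono_neutral_left) (use assms in \<open>auto simp: in_keys_iff\<close>)

instance
proof
  fix x y z :: "'a \<Rightarrow>\<^sub>0 'b" and r :: real
  let ?A = "Poly_Mapping.keys x \<union> Poly_Mapping.keys y"
  show "inner x y = inner y x"
    by (simp add: inner_poly_mapping_superset[of ?A] inner_commute)
  show "inner (x + y) z = inner x z + inner y z"
    using Poly_Mapping.keys_add[of x y]
    by (simp add: inner_poly_mapping_superset[of ?A] lookup_add inner_add_left sum.distrib)
  have "Poly_Mapping.keys (r *\<^sub>R x) \<subseteq> Poly_Mapping.keys x"
    by (auto simp: in_keys_iff)
  then show "inner (r *\<^sub>R x) y = r * inner x y"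
    by (simp add: inner_poly_mapping_superset[of "Poly_Mapping.keys x"] sum_distrib_left)
  show "0 \<le> inner x x"
    unfolding inner_poly_mapping_def by (intro sum_nonneg) simp
  show "inner x x = 0 \<longleftrightarrow> x = 0"
    unfolding inner_poly_mapping_def
    by (subst sum_nonneg_eq_0_iff) (auto simp: in_keys_iff intro: poly_mapping_eqI)
qed (fact norm_poly_mapping_def sgn_poly_mapping_def dist_poly_mapping_def
       uniformity_poly_mapping_def open_poly_mapping_def)+

end

type_synonym vec = "nat \<Rightarrow>\<^sub>0 real"

definition Rd :: "nat \<Rightarrow> vec set"
  where "Rd d = {x. Poly_Mapping.keys x \<subseteq> {..<d}}"

lemma inner_Rd:
  assumes "x \<in> Rd d"
  shows "inner x y = (\<Sum>i<d. Poly_Mapping.lookup x i * Poly_Mapping.lookup y i)"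
  using assms inner_poly_mapping_superset[of "{..<d}" x y] by (simp add: Rd_def)

lemma norm_Rd:
  assumes "x \<in> Rd d"
  shows "norm x = sqrt (\<Sum>i<d. (Poly_Mapping.lookup x i)\<^sup>2)"
  using inner_Rd[OF assms, of x] by (simp add: norm_eq_sqrt_inner power2_eq_square)

lemma zero_in_Rd [simp]: "0 \<in> Rd d"
  by (simp add: Rd_def)

lemma add_in_Rd: "x \<in> Rd d \<Longrightarrow> y \<in> Rd d \<Longrightarrow> x + y \<in> Rd d"
  using Poly_Mapping.keys_add[of x y] by (auto simp: Rd_def)

lemma scaleR_in_Rd: "x \<in> Rd d \<Longrightarrow> r *\<^sub>R x \<in> Rd d"
  by (auto simp: Rd_def in_keys_iff)

lemma subspace_Rd: "subspace (Rd d)"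
  by (simp add: subspace_def add_in_Rd scaleR_in_Rd)

definition unit_ball :: "nat \<Rightarrow> vec set"
  where "unit_ball d = {x \<in> Rd d. (norm x)\<^sup>2 \<le> 1}"

section \<open>Function classes\<close>

text \<open>
  The functions live on \<open>X\<close> only; their values elsewhere are irrelevant, so
  differentiability is taken within \<open>X\<close>.  For the unit ball the gradient is unique, see
  \<open>grad_unit_ball\<close> below.
\<close>

definition is_grad :: "nat \<Rightarrow> vec set \<Rightarrow> (vec \<Rightarrow> real) \<Rightarrow> vec \<Rightarrow> vec \<Rightarrow> bool"
  where "is_grad d X f x g \<longleftrightarrow>
           g \<in> Rd d \<and> (f has_derivative (\<lambda>h. inner g h)) (at x within X)"

definition grad :: "nat \<Rightarrow> vec set \<Rightarrow> (vec \<Rightarrow> real) \<Rightarrow> vec \<Rightarrow> vec"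
  where "grad d X f x = (THE g. is_grad d X f x g)"

text \<open>The class \<open>\<F>\<^sup>1\<^sup>,\<^sup>1\<close> with constant \<open>L\<close>; \<open>L\<close> need not be the least
  Lipschitz constant of the gradient.\<close>

definition F11 :: "nat \<Rightarrow> vec set \<Rightarrow> real \<Rightarrow> (vec \<Rightarrow> real) set"
  where "F11 d X L = {f. convex_on X f \<and> f differentiable_on X \<and> L-lipschitz_on X (grad d X f)}"

definition avg :: "nat \<Rightarrow> (nat \<Rightarrow> vec \<Rightarrow> real) \<Rightarrow> vec \<Rightarrow> real"
  where "avg K fs x = (\<Sum>i<K. fs i x) / real K"

definition min_value :: "vec set \<Rightarrow> (vec \<Rightarrow> real) \<Rightarrow> real"
  where "min_value X f = (INF x\<in>X. f x)"

lemma convex_unit_ball: "convex (unit_ball d)"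
proof -
  have "unit_ball d = Rd d \<inter> cball 0 1"
    by (auto simp: unit_ball_def power_le_one_iff abs_square_le_1)
  then show ?thesis
    by (simp add: convex_Int subspace_imp_convex subspace_Rd)
qed

lemma is_grad_unique:
  assumes x: "x \<in> unit_ball d"
    and g: "is_grad d (unit_ball d) f x g" and g': "is_grad d (unit_ball d) f x g'"
  shows "g = g'"
proof -
  let ?X = "unit_ball d"
  have eq: "inner g (y - x) = inner g' (y - x)" if y: "y \<in> ?X" for y
  proof -
    let ?c = "\<lambda>t::real. x + t *\<^sub>R (y - x)"
    have c0: "?c 0 = x" by simp
    have img: "?c ` {0..1} \<subseteq> ?X"
    proof clarsimp
      fix t :: real assume "0 \<le> t" "t \<le> 1"
      then have "(1 - t) *\<^sub>R x + t *\<^sub>R y \<in> ?X"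
        using convexD_alt[OF convex_unit_ball x y] by simp
      then show "x + t *\<^sub>R (y - x) \<in> ?X"
        by (simp add: algebra_simps)
    qed
    have *: "((\<lambda>t. f (?c t)) has_vector_derivative inner k (y - x)) (at 0 within {0..1})"
      if k: "is_grad d ?X f x k" for k
    proof -
      have c: "(?c has_derivative (\<lambda>t. t *\<^sub>R (y - x))) (at 0 within {0..1})"
        by (auto intro!: derivative_eq_intros)
      have "(f has_derivative (\<lambda>h. inner k h)) (at (?c 0) within ?c ` {0..1})"
        unfolding c0 using k has_derivative_subset[OF _ img] by (auto simp: is_grad_def)
      from diff_chain_within[OF c this]
      show ?thesis by (simp add: has_vector_derivative_def o_def)
    qed
    show ?thesis
      using vector_derivative_unique_within_closed_interval[of "0::real" 1 0]
        *[OF g] *[OF g'] by force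
  qed
  let ?u = "g - g'"
  have mem: "g \<in> Rd d" "g' \<in> Rd d" using g g' by (auto simp: is_grad_def)
  then have u: "?u \<in> Rd d" using subspace_diff[OF subspace_Rd] by blast
  have "sgn ?u \<in> ?X"
    using scaleR_in_Rd[OF u] by (cases "?u = 0") (auto simp: unit_ball_def sgn_div_norm)
  moreover have "0 \<in> ?X" by (simp add: unit_ball_def)
  ultimately have "inner ?u (sgn ?u) = 0"
    using eq[of "sgn ?u"] eq[of 0] by (simp add: inner_diff_left inner_diff_right)
  then have "norm ?u = 0"
    by (simp add: sgn_div_norm)
  then show ?thesis by simp
qed

lemma is_grad_exists:
  assumes "f differentiable (at x within unit_ball d)" and x: "x \<in> unit_ball d"
  shows "\<exists>g. is_grad d (unit_ball d) f x g"
proof -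
  obtain D where D: "(f has_derivative D) (at x within unit_ball d)"
    using assms by (auto simp: differentiable_def)
  then interpret D: bounded_linear D by (rule has_derivative_bounded_linear)
  define e where "e = (\<lambda>i::nat. Poly_Mapping.single i (1::real))"
  define g where "g = (\<Sum>i<d. D (e i) *\<^sub>R e i)"
  have e: "e i \<in> Rd d" if "i < d" for i using that by (simp add: e_def Rd_def)
  have g: "g \<in> Rd d"
    unfolding g_def by (intro subspace_sum[OF subspace_Rd] scaleR_in_Rd e) simp
  have lookup_sum_e: "Poly_Mapping.lookup (\<Sum>i<d. c i *\<^sub>R e i) j = (if j < d then c j else 0)"
    for c j
  proof -
    have "Poly_Mapping.lookup (\<Sum>i<d. c i *\<^sub>R e i) j = (\<Sum>i<d. if i = j then c i else 0)"
      unfolding lookup_sum by (rule sum.cong) (auto simp: e_def lookup_single when_def)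
    then show ?thesis by simp
  qed
  have D_eq: "D h = inner g h" if h: "h \<in> Rd d" for h
  proof -
    have "h = (\<Sum>i<d. Poly_Mapping.lookup h i *\<^sub>R e i)"
      using h by (intro poly_mapping_eqI) (auto simp: lookup_sum_e Rd_def in_keys_iff)
    then have "D h = (\<Sum>i<d. Poly_Mapping.lookup h i * D (e i))"
      using D.sum[of "\<lambda>i. Poly_Mapping.lookup h i *\<^sub>R e i" "{..<d}"] by (simp add: D.scaleR)
    also have "\<dots> = inner g h"
      unfolding inner_Rd[OF g] unfolding g_def by (simp add: lookup_sum_e mult.commute)
    finally show ?thesis .
  qed
  have "y - x \<in> Rd d" if "y \<in> unit_ball d" for y
    using that x subspace_diff[OF subspace_Rd] by (auto simp: unit_ball_def)
  then have "(f has_derivative (\<lambda>h. inner g h)) (at x within unit_ball d)"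
    using D unfolding has_derivative_within_alt
    by (auto simp: D_eq bounded_linear_inner_right)
  with g show ?thesis by (auto simp: is_grad_def)
qed

lemma grad_unit_ball:
  assumes "f differentiable_on unit_ball d" and "x \<in> unit_ball d"
  shows "is_grad d (unit_ball d) f x (grad d (unit_ball d) f x)"
proof -
  obtain g where g: "is_grad d (unit_ball d) f x g"
    using is_grad_exists[OF _ assms(2)] assms by (auto simp: differentiable_on_def)
  then show ?thesis
    unfolding grad_def using is_grad_unique[OF assms(2)] by (metis theI)
qed

section \<open>First-order methods\<close>

text \<open>
  A method sees the function only through the answers of its oracle: every query, and the
  output, is a function of the parameters of the problem, the initial point and the list of
  answers received so far (oldest first), and for a randomised method also of a random seed.
  The previous queries are determined by these data.
\<close>

primrec answers :: "('q \<Rightarrow> vec) \<Rightarrow> (vec list \<Rightarrow> 'q) \<Rightarrow> nat \<Rightarrow> vec list"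
  where
    "answers oracle q 0 = []"
  | "answers oracle q (Suc t) =
       (let as = answers oracle q t in as @ [oracle (q as)])"

text \<open>Arguments: dimension, constant \<open>L\<^sub>f\<close>, initial point, answers.\<close>

record full_method =
  full_query :: "nat \<Rightarrow> real \<Rightarrow> vec \<Rightarrow> vec list \<Rightarrow> vec"
  full_output :: "nat \<Rightarrow> real \<Rightarrow> vec \<Rightarrow> vec list \<Rightarrow> vec"

definition full_iterate ::
    "full_method \<Rightarrow> nat \<Rightarrow> real \<Rightarrow> vec \<Rightarrow> (vec \<Rightarrow> real) \<Rightarrow> nat \<Rightarrow> vec"
  where "full_iterate A d Lf x0 f s =
           full_output A d Lf x0 (answers (grad d (unit_ball d) f) (full_query A d Lf x0) s)"

definition deterministic_gradient_method :: "full_method \<Rightarrow> bool"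
  where "deterministic_gradient_method A \<longleftrightarrow>
    (\<forall>d. \<forall>Lf>0. \<forall>x0\<in>unit_ball d. \<forall>as.
       full_query A d Lf x0 as \<in> unit_ball d \<and> full_output A d Lf x0 as \<in> unit_ball d)"

definition optimal_full :: "full_method \<Rightarrow> bool"
  where "optimal_full A \<longleftrightarrow>
    deterministic_gradient_method A \<and>
    (\<exists>C1>0. \<forall>d. \<forall>Lf>0. \<forall>f\<in>F11 d (unit_ball d) Lf. \<forall>x0\<in>unit_ball d. \<forall>xs.
       is_arg_min f (\<lambda>x. x \<in> unit_ball d) xs \<longrightarrow>
       (\<forall>s\<ge>1. f (full_iterate A d Lf x0 f s) - min_value (unit_ball d) f
                 \<le> C1 * Lf * (norm (x0 - xs))\<^sup>2 / (real s)\<^sup>2))"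

text \<open>
  Arguments: dimension, number \<open>K\<close> of components, constants \<open>L\<^sub>b\<close> and \<open>L\<^sub>f\<close>, initial point,
  seed, answers.  The answer to a query \<open>(i, y)\<close> is the gradient of the component \<open>f\<^sub>i\<close> at
  \<open>y\<close>; components are numbered from \<open>0\<close>.
\<close>

record 'w stoch_method =
  seed :: "'w measure"
  stoch_query :: "nat \<Rightarrow> nat \<Rightarrow> real \<Rightarrow> real \<Rightarrow> vec \<Rightarrow> 'w \<Rightarrow> vec list \<Rightarrow> nat \<times> vec"
  stoch_output :: "nat \<Rightarrow> nat \<Rightarrow> real \<Rightarrow> real \<Rightarrow> vec \<Rightarrow> 'w \<Rightarrow> vec list \<Rightarrow> vec"

text \<open>The iterate with index \<open>s\<close> is the output after \<open>s * K\<close> stochastic gradient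
  evaluations.\<close>

definition stoch_iterate ::
    "'w stoch_method \<Rightarrow> nat \<Rightarrow> nat \<Rightarrow> real \<Rightarrow> real \<Rightarrow> vec \<Rightarrow> (nat \<Rightarrow> vec \<Rightarrow> real) \<Rightarrow> nat \<Rightarrow> 'w \<Rightarrow> vec"
  where "stoch_iterate A d K Lb Lf x0 fs s w =
           stoch_output A d K Lb Lf x0 w
             (answers (\<lambda>(i, y). grad d (unit_ball d) (fs i) y)
                (stoch_query A d K Lb Lf x0 w) (s * K))"

definition finite_sum_instance ::
    "nat \<Rightarrow> nat \<Rightarrow> real \<Rightarrow> real \<Rightarrow> (nat \<Rightarrow> vec \<Rightarrow> real) \<Rightarrow> bool"
  where "finite_sum_instance d K Lb Lf fs \<longleftrightarrow>
           (\<forall>i<K. fs i \<in> F11 d (unit_ball d) Lb) \<and> avg K fs \<in> F11 d (unit_ball d) Lf"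

definition stochastic_gradient_method :: "'w stoch_method \<Rightarrow> bool"
  where "stochastic_gradient_method A \<longleftrightarrow>
    prob_space (seed A) \<and>
    (\<forall>d. \<forall>K\<ge>1. \<forall>Lb>0. \<forall>Lf>0. \<forall>x0\<in>unit_ball d.
       (\<forall>w\<in>space (seed A). \<forall>as.
          stoch_query A d K Lb Lf x0 w as \<in> {..<K} \<times> unit_ball d \<and>
          stoch_output A d K Lb Lf x0 w as \<in> unit_ball d) \<and>
       (\<forall>fs s. finite_sum_instance d K Lb Lf fs \<longrightarrow>
          stoch_iterate A d K Lb Lf x0 fs s \<in> measurable (seed A) borel))"

definition expected_value ::
    "'w stoch_method \<Rightarrow> nat \<Rightarrow> nat \<Rightarrow> real \<Rightarrow> real \<Rightarrow> vec \<Rightarrow> (nat \<Rightarrow> vec \<Rightarrow> real) \<Rightarrow> nat \<Rightarrow> real"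
  where "expected_value A d K Lb Lf x0 fs s =
           integral\<^sup>L (seed A) (\<lambda>w. avg K fs (stoch_iterate A d K Lb Lf x0 fs s w))"

definition optimal_stoch :: "'w stoch_method \<Rightarrow> bool"
  where "optimal_stoch A \<longleftrightarrow>
    stochastic_gradient_method A \<and>
    (\<exists>C2>0. \<exists>C3>0. \<forall>d. \<forall>K\<ge>1. \<forall>Lb>0. \<forall>Lf>0. \<forall>fs. finite_sum_instance d K Lb Lf fs \<longrightarrow>
       (\<forall>x0\<in>unit_ball d. \<forall>xs. is_arg_min (avg K fs) (\<lambda>x. x \<in> unit_ball d) xs \<longrightarrow>
         (\<forall>s\<ge>1. expected_value A d K Lb Lf x0 fs s - min_value (unit_ball d) (avg K fs)
            \<le> C2 * (avg K fs x0 - min_value (unit_ball d) (avg K fs)) / (real s)\<^sup>2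
              + C3 * Lb * (norm (x0 - xs))\<^sup>2 / (real K * (real s)\<^sup>2))))"

end

theory Submission
  imports Defs
begin

text \<open>
  Each component is a chain of quadratic penalties
  \<open>(max 0 (y\<^bsub>j - 1\<^esub> - y\<^bsub>j\<^esub> - \<tau>))\<^sup>2 / 2\<close> on its own \<open>N = 2 s\<close> coordinates, with
  \<open>y\<^bsub>-1\<^esub>\<close> replaced by a constant \<open>a\<close>, scaled by \<open>L\<^sub>b / 4\<close>.  It vanishes at the constant
  vector \<open>a\<close>, but a point with \<open>y\<^bsub>N - 1\<^esub>\<close> almost \<open>0\<close> has to descend from \<open>a\<close> to \<open>0\<close> in \<open>N\<close>
  steps, which costs about \<open>L\<^sub>b a\<^sup>2 / N\<close>.  The norm of the minimiser is \<open>1\<close> for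
  \<open>a\<^sup>2 = 1 / (K N)\<close>, so the cost is of order \<open>L\<^sub>b / (K s\<^sup>2)\<close> per component.  As the components
  use disjoint coordinates, their average has an \<open>L\<^sub>b / K\<close>-Lipschitz gradient.

  The coordinates are placed at random among very many.  A point of the unit ball has at most
  \<open>4 / \<tau>\<^sup>2\<close> coordinates above \<open>\<tau> / 2\<close> in modulus, hence with high probability a query is small on
  all coordinates of which the answers so far are independent, and the dead zone \<open>\<tau>\<close> then lets it
  reveal at most the next coordinate of a chain.  After \<open>s K\<close> component gradients, at least half
  of the components have been visited fewer than \<open>N\<close> times, so the output is small at the ends
  of their chains.  The error of the full gradient method is at most \<open>4 C\<^sub>1 L\<^sub>f / s\<^sup>2\<close>, since the
  unit ball has diameter \<open>2\<close>.
\<close>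

section \<open>Chains of one-sided quadratic penalties\<close>

text \<open>\<open>\<pi>\<close> places link \<open>j\<close> of chain \<open>i\<close> at a
  coordinate of the space. Pairing with \<open>edge \<pi> p\<close> gives the linear part of the
  descent along a link; the constant that precedes link 0 is added in \<open>excess\<close>.\<close>

definition edge :: "(nat \<times> nat \<Rightarrow> nat) \<Rightarrow> nat \<times> nat \<Rightarrow> vec"
  where "edge \<pi> p = (if snd p = 0 then 0 else Poly_Mapping.single (\<pi> (fst p, snd p - 1)) 1)
                        - Poly_Mapping.single (\<pi> p) 1"

definition excess :: "real \<Rightarrow> real \<Rightarrow> (nat \<times> nat \<Rightarrow> nat) \<Rightarrow> nat \<times> nat \<Rightarrow> vec \<Rightarrow> real"
  where "excess a \<tau> \<pi> p x = max 0 ((if snd p = 0 then a else 0) - \<tau> + inner (edge \<pi> p) x)"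

text \<open>The set \<open>J\<close> of links is left open so that one formula covers a single
  component, the average of all components, and chains whose ends are cut off.\<close>

definition energy ::
    "real \<Rightarrow> real \<Rightarrow> (nat \<times> nat \<Rightarrow> nat) \<Rightarrow> real \<Rightarrow> (nat \<times> nat) set \<Rightarrow> vec \<Rightarrow> real"
  where "energy a \<tau> \<pi> M J x = M * (\<Sum>p\<in>J. (excess a \<tau> \<pi> p x)\<^sup>2 / 2)"

definition energy_grad ::
    "real \<Rightarrow> real \<Rightarrow> (nat \<times> nat \<Rightarrow> nat) \<Rightarrow> real \<Rightarrow> (nat \<times> nat) set \<Rightarrow> vec \<Rightarrow> vec"
  where "energy_grad a \<tau> \<pi> M J x = M *\<^sub>R (\<Sum>p\<in>J. excess a \<tau> \<pi> p x *\<^sub>R edge \<pi> p)"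

lemma inner_single_left: "inner (Poly_Mapping.single k (1::real)) x = Poly_Mapping.lookup x k"
  using inner_poly_mapping_superset[of "{k}" "Poly_Mapping.single k (1::real)" x] by simp

lemma inner_edge:
  "inner (edge \<pi> (i, j)) x =
     (if j = 0 then 0 else Poly_Mapping.lookup x (\<pi> (i, j - 1))) - Poly_Mapping.lookup x (\<pi> (i, j))"
  by (simp add: edge_def inner_diff_left inner_single_left)

lemma excess_eq:
  "excess a \<tau> \<pi> (i, j) x =
     max 0 ((if j = 0 then a else Poly_Mapping.lookup x (\<pi> (i, j - 1)))
              - Poly_Mapping.lookup x (\<pi> (i, j)) - \<tau>)"
  by (simp add: excess_def inner_edge algebra_simps)

lemma sum_lookup_squares_le:
  fixes x :: vec
  assumes "finite A" "inj_on g A"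
  shows "(\<Sum>p\<in>A. (Poly_Mapping.lookup x (g p))\<^sup>2) \<le> (norm x)\<^sup>2"
proof -
  have "(\<Sum>p\<in>A. (Poly_Mapping.lookup x (g p))\<^sup>2) = (\<Sum>k\<in>g ` A. (Poly_Mapping.lookup x k)\<^sup>2)"
    using assms by (simp add: sum.reindex)
  also have "\<dots> \<le> (\<Sum>k\<in>g ` A \<union> Poly_Mapping.keys x. (Poly_Mapping.lookup x k)\<^sup>2)"
    by (intro sum_mono2) (use assms in auto)
  also have "\<dots> = (norm x)\<^sup>2"
    unfolding power2_norm_eq_inner
    using inner_poly_mapping_superset[of "g ` A \<union> Poly_Mapping.keys x" x x] assms
    by (simp add: power2_eq_square)
  finally show ?thesis .
qed

section \<open>Differentiability and convexity of the energy\<close>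

lemma has_real_derivative_half_square_pos_part:
  "((\<lambda>t. (max 0 t)\<^sup>2 / 2) has_real_derivative max 0 t) (at (t::real))"
proof -
  \<comment> \<open>A Taylor bound: \<open>max 0\<close> is 1-Lipschitz, so the first-order
    remainder of its primitive is at most half the squared increment.\<close>
  have main: "\<bar>(max 0 u)\<^sup>2 / 2 - (max 0 t)\<^sup>2 / 2 - max 0 t * (u - t)\<bar> \<le> (u - t)\<^sup>2 / 2" for u :: real
  proof -
    consider "0 \<le> u" "0 \<le> t" | "0 \<le> u" "t \<le> 0" | "u \<le> 0" "0 \<le> t" | "u \<le> 0" "t \<le> 0" by linarith
    then show ?thesis
    proof cases
      case 1
      have eq: "u\<^sup>2 / 2 - t\<^sup>2 / 2 - t * (u - t) = (u - t)\<^sup>2 / 2"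
        by (simp add: power2_eq_square field_simps)
      have pos: "max 0 u = u" "max 0 t = t" using 1 by auto
      show ?thesis unfolding pos eq by simp
    next
      case 2
      then have "u\<^sup>2 \<le> (u - t)\<^sup>2" by (intro power_mono) auto
      with 2 show ?thesis by (simp add: max_def)
    next
      case 3
      then have "u * t \<le> 0" by (simp add: mult_nonpos_nonneg)
      moreover have "(u - t)\<^sup>2 = u\<^sup>2 - 2 * (u * t) + t\<^sup>2" "t * (u - t) = u * t - t\<^sup>2"
        by (simp_all add: power2_eq_square algebra_simps)
      moreover have "0 \<le> t\<^sup>2" "0 \<le> u\<^sup>2" by simp_all
      ultimately have le: "\<bar>0\<^sup>2 / 2 - t\<^sup>2 / 2 - t * (u - t)\<bar> \<le> (u - t)\<^sup>2 / 2"
        unfolding zero_power2 by linarith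
      have neg: "max 0 u = 0" "max 0 t = t" using 3 by auto
      show ?thesis unfolding neg by (rule le)
    next
      case 4 then show ?thesis by (simp add: max_def)
    qed
  qed
  have "((\<lambda>u. \<bar>u - t\<bar> / 2) \<longlongrightarrow> \<bar>t - t\<bar> / 2) (at t)"
    by (intro tendsto_divide tendsto_rabs tendsto_diff tendsto_ident_at tendsto_const) simp
  then have lim: "((\<lambda>u. \<bar>u - t\<bar> / 2) \<longlongrightarrow> 0) (at t)"
    by simp
  define F :: "real \<Rightarrow> real" where "F = (\<lambda>t. (max 0 t)\<^sup>2 / 2)"
  have "norm ((F u - F t) / (u - t) - max 0 t) \<le> \<bar>u - t\<bar> / 2" if "u \<noteq> t" for u
  proof -
    have "(F u - F t) / (u - t) - max 0 t = (F u - F t - max 0 t * (u - t)) / (u - t)"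
      using that by (simp add: diff_divide_distrib)
    then have "norm ((F u - F t) / (u - t) - max 0 t) = \<bar>F u - F t - max 0 t * (u - t)\<bar> / \<bar>u - t\<bar>"
      by (simp add: abs_divide)
    also have "\<dots> \<le> ((u - t)\<^sup>2 / 2) / \<bar>u - t\<bar>"
      unfolding F_def by (intro divide_right_mono main) simp
    also have "\<dots> = \<bar>u - t\<bar> / 2"
      using that by (simp add: field_simps power2_eq_square)
    finally show ?thesis .
  qed
  then have "((\<lambda>u. (F u - F t) / (u - t) - max 0 t) \<longlongrightarrow> 0) (at t)"
    by (intro Lim_null_comparison[OF _ lim]) (simp add: eventually_at_filter)
  then have "(F has_real_derivative max 0 t) (at t)"
    unfolding has_field_derivative_iff by (rule LIM_zero_cancel)
  then show ?thesis by (simp add: F_def)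
qed

lemma energy_has_derivative:
  "(energy a \<tau> \<pi> M J has_derivative (\<lambda>h. inner (energy_grad a \<tau> \<pi> M J x) h)) (at x within S)"
proof -
  have "((\<lambda>x. (excess a \<tau> \<pi> p x)\<^sup>2 / 2) has_derivative (\<lambda>h. inner (edge \<pi> p) h * excess a \<tau> \<pi> p x))
          (at x within S)" for p
  proof -
    let ?l = "\<lambda>x. (if snd p = 0 then a else 0) - \<tau> + inner (edge \<pi> p) x"
    have "(?l has_derivative (\<lambda>h. inner (edge \<pi> p) h)) (at x within S)"
      by (auto intro!: derivative_eq_intros)
    then show ?thesis
      unfolding excess_def
      by (rule DERIV_compose_FDERIV[OF has_real_derivative_half_square_pos_part])
  qed
  then have "((\<lambda>x. M * (\<Sum>p\<in>J. (excess a \<tau> \<pi> p x)\<^sup>2 / 2)) has_derivative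
      (\<lambda>h. M * (\<Sum>p\<in>J. inner (edge \<pi> p) h * excess a \<tau> \<pi> p x))) (at x within S)"
    by (intro has_derivative_mult_right has_derivative_sum)
  moreover have "energy a \<tau> \<pi> M J = (\<lambda>x. M * (\<Sum>p\<in>J. (excess a \<tau> \<pi> p x)\<^sup>2 / 2))"
    by (simp add: fun_eq_iff energy_def)
  ultimately show ?thesis
    by (simp add: energy_grad_def inner_sum_left mult.commute)
qed

lemma excess_nonneg: "0 \<le> excess a \<tau> \<pi> p x"
  by (simp add: excess_def)

text \<open>\<open>excess\<close> is the positive part of an affine function, hence convex and
  nonnegative. Squaring preserves this, because the square of a convex combination falls short of
  the combination of the squares by \<open>t * (1 - t)\<close> times the squared difference.\<close>

lemma energy_convex:
  assumes "0 \<le> M" "convex X"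
  shows "convex_on X (energy a \<tau> \<pi> M J)"
proof -
  have "convex_on X (\<lambda>x. (excess a \<tau> \<pi> p x)\<^sup>2 / 2)" for p
  proof (rule convex_onI)
    fix t :: real and x y :: vec
    assume t: "0 < t" "t < 1"
    let ?e = "excess a \<tau> \<pi> p"
    have "(if snd p = 0 then a else 0) - \<tau> + inner (edge \<pi> p) ((1 - t) *\<^sub>R x + t *\<^sub>R y)
      = (1 - t) * ((if snd p = 0 then a else 0) - \<tau> + inner (edge \<pi> p) x)
         + t * ((if snd p = 0 then a else 0) - \<tau> + inner (edge \<pi> p) y)"
      by (simp add: inner_add_right algebra_simps)
    also have "\<dots> \<le> (1 - t) * ?e x + t * ?e y"
      unfolding excess_def using t by (intro add_mono mult_left_mono) auto
    finally have "?e ((1 - t) *\<^sub>R x + t *\<^sub>R y) \<le> (1 - t) * ?e x + t * ?e y"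
      using t by (auto simp: excess_def[of _ _ _ _ "_ + _"] intro!: add_nonneg_nonneg mult_nonneg_nonneg excess_nonneg)
    then have "(?e ((1 - t) *\<^sub>R x + t *\<^sub>R y))\<^sup>2 \<le> ((1 - t) * ?e x + t * ?e y)\<^sup>2"
      using excess_nonneg by (intro power_mono)
    also have "\<dots> = (1 - t) * (?e x)\<^sup>2 + t * (?e y)\<^sup>2 - t * (1 - t) * (?e x - ?e y)\<^sup>2"
      by (simp add: power2_eq_square algebra_simps)
    also have "\<dots> \<le> (1 - t) * (?e x)\<^sup>2 + t * (?e y)\<^sup>2"
      using t by simp
    finally show "(?e ((1 - t) *\<^sub>R x + t *\<^sub>R y))\<^sup>2 / 2 \<le> (1 - t) * ((?e x)\<^sup>2 / 2) + t * ((?e y)\<^sup>2 / 2)"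
      by (simp add: field_simps)
  qed fact
  then have "convex_on X (\<lambda>x. \<Sum>p\<in>J. (excess a \<tau> \<pi> p x)\<^sup>2 / 2)"
  proof (induction J rule: infinite_finite_induct)
    case (insert p J)
    then show ?case by (simp add: convex_on_add)
  qed (use assms in \<open>simp_all add: convex_on_const\<close>)
  then have "convex_on X (\<lambda>x. M * (\<Sum>p\<in>J. (excess a \<tau> \<pi> p x)\<^sup>2 / 2))"
    by (intro convex_on_cmul assms)
  moreover have "energy a \<tau> \<pi> M J = (\<lambda>x. M * (\<Sum>p\<in>J. (excess a \<tau> \<pi> p x)\<^sup>2 / 2))"
    by (simp add: fun_eq_iff energy_def)
  ultimately show ?thesis
    by simp
qed

section \<open>The Lipschitz constant of the gradient\<close>

text \<open>A squared difference is at most twice the sum of the squares, and by injectivity each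
  coordinate occurs in at most two links. So the linear map with rows \<open>edge \<pi> p\<close>
  has norm at most 2.\<close>

lemma sum_inner_edge_squares_le:
  assumes "finite I" and inj: "inj_on \<pi> (I \<times> {..<N})"
  shows "(\<Sum>p\<in>I \<times> {..<N}. (inner (edge \<pi> p) u)\<^sup>2) \<le> 4 * (norm u)\<^sup>2"
proof -
  let ?J = "I \<times> {..<N}" and ?y = "\<lambda>p. (Poly_Mapping.lookup u (\<pi> p))\<^sup>2"
  let ?z = "\<lambda>p. if snd p = 0 then 0 else ?y (fst p, snd p - 1)"
  have "(inner (edge \<pi> p) u)\<^sup>2 \<le> 2 * ?z p + 2 * ?y p" for p
  proof (cases p)
    case (Pair i j)
    have "(c - b)\<^sup>2 \<le> 2 * c\<^sup>2 + 2 * b\<^sup>2" for b c :: real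
      using zero_le_power2[of "c + b"] by (simp add: power2_eq_square algebra_simps)
    then show ?thesis by (simp add: Pair inner_edge)
  qed
  then have "(\<Sum>p\<in>?J. (inner (edge \<pi> p) u)\<^sup>2) \<le> (\<Sum>p\<in>?J. 2 * ?z p + 2 * ?y p)"
    by (rule sum_mono)
  also have "\<dots> = 2 * (\<Sum>p\<in>?J. ?z p) + 2 * (\<Sum>p\<in>?J. ?y p)"
    by (simp add: sum.distrib sum_distrib_left)
  also have "(\<Sum>p\<in>?J. ?z p) = (\<Sum>p\<in>?J \<inter> {p. snd p \<noteq> 0}. ?y (fst p, snd p - 1))"
    using \<open>finite I\<close> by (subst sum.inter_restrict) (auto intro!: sum.cong)
  also have "\<dots> = (\<Sum>p\<in>(\<lambda>p. (fst p, snd p - 1)) ` (?J \<inter> {p. snd p \<noteq> 0}). ?y p)"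
    by (subst sum.reindex) (auto simp: inj_on_def)
  also have "\<dots> \<le> (\<Sum>p\<in>?J. ?y p)"
    using \<open>finite I\<close> by (intro sum_mono2) auto
  also have "(\<Sum>p\<in>?J. ?y p) \<le> (norm u)\<^sup>2"
    using \<open>finite I\<close> inj by (intro sum_lookup_squares_le) auto
  finally show ?thesis by simp
qed

text \<open>With \<open>E\<close> the linear map whose rows are the edges, the gradient is
  \<open>M\<close> times the transpose of \<open>E\<close> applied to the positive part of an affine
  function with linear part \<open>E\<close>. Taking positive parts is nonexpansive, so
  \<open>E\<close> and its transpose contribute a factor 2 each; Cauchy-Schwarz transfers the bound
  to the transpose.\<close>

lemma energy_grad_lipschitz:
  assumes "finite I" "inj_on \<pi> (I \<times> {..<N})" "0 \<le> M"
  shows "norm (energy_grad a \<tau> \<pi> M (I \<times> {..<N}) x - energy_grad a \<tau> \<pi> M (I \<times> {..<N}) y)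
           \<le> 4 * M * norm (x - y)"
proof -
  let ?J = "I \<times> {..<N}"
  define c where "c p = excess a \<tau> \<pi> p x - excess a \<tau> \<pi> p y" for p
  define v where "v = (\<Sum>p\<in>?J. c p *\<^sub>R edge \<pi> p)"
  have fin: "finite ?J" using assms by simp
  have "(c p)\<^sup>2 \<le> (inner (edge \<pi> p) (x - y))\<^sup>2" for p
  proof -
    have "\<bar>c p\<bar> \<le> \<bar>inner (edge \<pi> p) (x - y)\<bar>"
      by (auto simp: c_def excess_def inner_diff_right)
    then show ?thesis by (rule abs_le_square_iff[THEN iffD1])
  qed
  then have "(\<Sum>p\<in>?J. (c p)\<^sup>2) \<le> (\<Sum>p\<in>?J. (inner (edge \<pi> p) (x - y))\<^sup>2)"
    by (rule sum_mono)
  then have c: "(\<Sum>p\<in>?J. (c p)\<^sup>2) \<le> 4 * (norm (x - y))\<^sup>2"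
    using sum_inner_edge_squares_le[OF assms(1,2), of "x - y"] by simp
  have "(norm v)\<^sup>2 = (\<Sum>p\<in>?J. c p * inner (edge \<pi> p) v)"
    by (subst power2_norm_eq_inner, subst v_def) (simp add: inner_sum_left)
  then have "((norm v)\<^sup>2)\<^sup>2 \<le> (\<Sum>p\<in>?J. (c p)\<^sup>2) * (\<Sum>p\<in>?J. (inner (edge \<pi> p) v)\<^sup>2)"
    using Cauchy_Schwarz_ineq_sum[of c "\<lambda>p. inner (edge \<pi> p) v" ?J] by simp
  also have "\<dots> \<le> (4 * (norm (x - y))\<^sup>2) * (4 * (norm v)\<^sup>2)"
    by (intro mult_mono c sum_inner_edge_squares_le assms sum_nonneg) auto
  finally have "(norm v * norm v)\<^sup>2 \<le> (4 * norm (x - y) * norm v)\<^sup>2"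
    by (simp add: power2_eq_square mult_ac)
  then have "norm v * norm v \<le> 4 * norm (x - y) * norm v"
    by (rule power2_le_imp_le) simp
  then have "norm v \<le> 4 * norm (x - y)"
    by (cases "v = 0") auto
  moreover have "energy_grad a \<tau> \<pi> M ?J x - energy_grad a \<tau> \<pi> M ?J y = M *\<^sub>R v"
    by (simp add: energy_grad_def v_def c_def scaleR_diff_left sum_subtractf scaleR_diff_right)
  ultimately show ?thesis
    using assms(3) mult_left_mono[of "norm v" "4 * norm (x - y)" M] by simp
qed

lemma energy_grad_in_Rd:
  assumes "\<pi> ` (I \<times> {..<N}) \<subseteq> {..<d}"
  shows "energy_grad a \<tau> \<pi> M (I \<times> {..<N}) x \<in> Rd d"
proof -
  have "edge \<pi> p \<in> Rd d" if "p \<in> I \<times> {..<N}" for p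
    unfolding edge_def using that assms
    by (intro subspace_diff[OF subspace_Rd]) (auto simp: Rd_def image_subset_iff)
  then show ?thesis
    unfolding energy_grad_def by (intro scaleR_in_Rd subspace_sum[OF subspace_Rd])
qed

lemma grad_energy:
  assumes "\<pi> ` (I \<times> {..<N}) \<subseteq> {..<d}" "x \<in> unit_ball d"
  shows "grad d (unit_ball d) (energy a \<tau> \<pi> M (I \<times> {..<N})) x = energy_grad a \<tau> \<pi> M (I \<times> {..<N}) x"
proof -
  have "is_grad d (unit_ball d) (energy a \<tau> \<pi> M (I \<times> {..<N})) x (energy_grad a \<tau> \<pi> M (I \<times> {..<N}) x)"
    using energy_grad_in_Rd[OF assms(1)] energy_has_derivative by (simp add: is_grad_def)
  then show ?thesis
    unfolding grad_def using is_grad_unique[OF assms(2)] by (intro the_equality)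
qed

lemma energy_in_F11:
  assumes "finite I" "inj_on \<pi> (I \<times> {..<N})" "\<pi> ` (I \<times> {..<N}) \<subseteq> {..<d}" "0 \<le> M" "4 * M \<le> L"
  shows "energy a \<tau> \<pi> M (I \<times> {..<N}) \<in> F11 d (unit_ball d) L"
  unfolding F11_def
proof (intro CollectI conjI)
  show "convex_on (unit_ball d) (energy a \<tau> \<pi> M (I \<times> {..<N}))"
    by (intro energy_convex assms convex_unit_ball)
  show "energy a \<tau> \<pi> M (I \<times> {..<N}) differentiable_on unit_ball d"
    unfolding differentiable_on_def differentiable_def using energy_has_derivative by blast
  show "L-lipschitz_on (unit_ball d) (grad d (unit_ball d) (energy a \<tau> \<pi> M (I \<times> {..<N})))"
  proof (rule lipschitz_onI)
    fix x y assume "x \<in> unit_ball d" "y \<in> unit_ball d"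
    moreover have "4 * M * norm (x - y) \<le> L * norm (x - y)"
      by (intro mult_right_mono assms) simp
    ultimately show "dist (grad d (unit_ball d) (energy a \<tau> \<pi> M (I \<times> {..<N})) x)
            (grad d (unit_ball d) (energy a \<tau> \<pi> M (I \<times> {..<N})) y) \<le> L * dist x y"
      using energy_grad_lipschitz[OF assms(1,2,4), of a \<tau> x y] assms(3)
      by (simp add: grad_energy dist_norm)
  qed (use assms in auto)
qed

section \<open>Hiding coordinates from a first-order method\<close>

lemma answers_cong:
  assumes "\<And>as. oracle (q as) = oracle' (q as)"
  shows "answers oracle q t = answers oracle' q t"
  by (induction t) (simp_all add: Let_def assms)

text \<open>The parameter \<open>comps\<close> accommodates both oracles: a full gradient touches
  every component, a stochastic one only the component queried.\<close>

definition visits :: "('q \<Rightarrow> nat set) \<Rightarrow> ('q \<Rightarrow> vec) \<Rightarrow> (vec list \<Rightarrow> 'q) \<Rightarrow> nat \<Rightarrow> nat \<Rightarrow> nat"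
  where "visits comps oracle q i t = card {u. u < t \<and> i \<in> comps (q (answers oracle q u))}"

lemma visits_Suc:
  "visits comps oracle q i (Suc t) =
     visits comps oracle q i t + (if i \<in> comps (q (answers oracle q t)) then 1 else 0)"
proof -
  have "{u. u < Suc t \<and> i \<in> comps (q (answers oracle q u))} =
     (if i \<in> comps (q (answers oracle q t)) then insert t else (\<lambda>A. A))
        {u. u < t \<and> i \<in> comps (q (answers oracle q u))}"
    by (auto simp: less_Suc_eq)
  then show ?thesis by (simp add: visits_def)
qed

text \<open>Think of \<open>hidden (i, j)\<close> as the oracle with chain \<open>i\<close> cut off
  from link \<open>j\<close> on, and of \<open>quiet (i, l) x\<close> as \<open>x\<close> being
  small at link \<open>l\<close>. Induction on \<open>t\<close> for all \<open>i\<close> and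
  \<open>j\<close> at once: if the next query visits \<open>i\<close>, there were at most
  \<open>j - 1\<close> visits before, so for every \<open>l\<close> from \<open>j - 1\<close> on the
  answers so far are also those of \<open>hidden (i, l)\<close>, and \<open>small\<close> makes the
  query quiet at \<open>l\<close>. A query that does not visit \<open>i\<close> cannot tell the
  oracles apart.\<close>

lemma answers_hidden:
  assumes small: "\<And>u i j. u < T \<Longrightarrow> i < K \<Longrightarrow> j < N \<Longrightarrow> quiet (i, j) (q (answers (hidden (i, j)) q u))"
    and same: "\<And>i j x. i < K \<Longrightarrow> j < N \<Longrightarrow>
        (i \<in> comps x \<Longrightarrow> 0 < j \<and> (\<forall>l. j - 1 \<le> l \<longrightarrow> l < N \<longrightarrow> quiet (i, l) x)) \<Longrightarrow>
        oracle x = hidden (i, j) x"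
    and "t \<le> T" "i < K" "j < N" "visits comps oracle q i t \<le> j"
  shows "answers oracle q t = answers (hidden (i, j)) q t"
  using assms(3-)
proof (induction t arbitrary: i j)
  case (Suc t)
  let ?x = "q (answers oracle q t)"
  have IH: "answers oracle q t = answers (hidden (k, l)) q t"
    if "k < K" "l < N" "visits comps oracle q k t \<le> l" for k l
    using Suc.IH[OF _ that] Suc.prems by simp
  have eq: "answers oracle q t = answers (hidden (i, j)) q t"
    using Suc.prems by (intro IH) (simp_all add: visits_Suc split: if_splits)
  have "oracle ?x = hidden (i, j) ?x"
  proof (rule same)
    assume "i \<in> comps ?x"
    then have v: "visits comps oracle q i t + 1 \<le> j"
      using Suc.prems by (simp add: visits_Suc)
    have "quiet (i, l) ?x" if "j - 1 \<le> l" "l < N" for l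
    proof -
      have "answers oracle q t = answers (hidden (i, l)) q t"
        using that v Suc.prems by (intro IH) simp_all
      then show ?thesis
        using small[of t i l] that Suc.prems by simp
    qed
    with v show "0 < j \<and> (\<forall>l. j - 1 \<le> l \<longrightarrow> l < N \<longrightarrow> quiet (i, l) ?x)"
      by auto
  qed fact+
  with eq show ?case by (simp add: Let_def)
qed simp

text \<open>Two coordinates of modulus at most \<open>\<tau> / 2\<close> differ by at most the dead
  zone. Quietness starts at \<open>j - 1\<close> because link \<open>j\<close> compares with its
  predecessor, and \<open>0 < j\<close> keeps the constant \<open>a\<close> out of the
  comparison.\<close>

lemma energy_grad_remove_quiet:
  assumes "\<And>l. j - 1 \<le> l \<Longrightarrow> l < N \<Longrightarrow> \<bar>Poly_Mapping.lookup x (\<pi> (i, l))\<bar> \<le> \<tau> / 2"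
    and "0 < j" "finite I"
  shows "energy_grad a \<tau> \<pi> M (I \<times> {..<N}) x = energy_grad a \<tau> \<pi> M (I \<times> {..<N} - {i} \<times> {j..}) x"
proof -
  have "excess a \<tau> \<pi> p x = 0" if p: "p \<in> I \<times> {..<N} \<inter> {i} \<times> {j..}" for p
  proof -
    obtain l where l: "p = (i, l)" "j \<le> l" "l < N" using p by auto
    have "\<bar>Poly_Mapping.lookup x (\<pi> (i, l))\<bar> \<le> \<tau> / 2" "\<bar>Poly_Mapping.lookup x (\<pi> (i, l - 1))\<bar> \<le> \<tau> / 2"
      using l by (intro assms(1); simp)+
    then have "Poly_Mapping.lookup x (\<pi> (i, l - 1)) - Poly_Mapping.lookup x (\<pi> (i, l)) - \<tau> \<le> 0"
      by linarith
    with l \<open>0 < j\<close> show ?thesis by (simp add: excess_eq)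
  qed
  then have "(\<Sum>p\<in>I \<times> {..<N}. excess a \<tau> \<pi> p x *\<^sub>R edge \<pi> p) =
      (\<Sum>p\<in>I \<times> {..<N} - {i} \<times> {j..}. excess a \<tau> \<pi> p x *\<^sub>R edge \<pi> p)"
    using \<open>finite I\<close> by (intro sum.mono_neutral_right) auto
  then show ?thesis by (simp add: energy_grad_def)
qed

text \<open>Hiding the end of chain \<open>i\<close> from link \<open>j\<close> on removes every term in which the
  coordinate \<open>\<pi> (i, j)\<close> occurs.\<close>

lemma energy_grad_hidden_upd:
  "energy_grad a \<tau> (\<pi>(p := k)) M (J - {fst p} \<times> {snd p..}) x =
   energy_grad a \<tau> \<pi> M (J - {fst p} \<times> {snd p..}) x"
proof -
  have "edge (\<pi>(p := k)) r = edge \<pi> r" if "r \<in> J - {fst p} \<times> {snd p..}" for r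
    using that by (cases p; cases r) (auto simp: edge_def)
  then show ?thesis
    by (simp add: energy_grad_def excess_def)
qed

section \<open>Random placement of the coordinates\<close>

text \<open>Every link has its own pool of coordinates, from which \<open>\<sigma>\<close> selects
  one. This makes each placement injective and lets one link be moved without affecting the
  others.\<close>

definition scatter :: "(nat \<times> nat \<Rightarrow> nat) \<Rightarrow> nat \<times> nat \<Rightarrow> nat"
  where "scatter \<sigma> p = prod_encode (prod_encode p, \<sigma> p)"

lemma inj_scatter: "inj (scatter \<sigma>)"
  by (auto simp: inj_def scatter_def)

lemma scatter_upd: "scatter (\<sigma>(p := v)) = (scatter \<sigma>)(p := prod_encode (prod_encode p, v))"
  by (auto simp: scatter_def fun_eq_iff)

lemma card_large_coordinates:
  fixes y :: vec
  assumes "norm y \<le> 1" "0 < \<delta>" "inj g" "finite A"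
  shows "real (card {v\<in>A. \<delta> < \<bar>Poly_Mapping.lookup y (g v)\<bar>}) \<le> 1 / \<delta>\<^sup>2"
proof -
  let ?A = "{v\<in>A. \<delta> < \<bar>Poly_Mapping.lookup y (g v)\<bar>}"
  have "real (card ?A) * \<delta>\<^sup>2 = (\<Sum>v\<in>?A. \<delta>\<^sup>2)" by simp
  also have "\<dots> \<le> (\<Sum>v\<in>?A. (Poly_Mapping.lookup y (g v))\<^sup>2)"
    using \<open>0 < \<delta>\<close> by (intro sum_mono) (auto simp flip: abs_le_square_iff)
  also have "\<dots> \<le> (norm y)\<^sup>2"
    using assms by (intro sum_lookup_squares_le) (auto simp: inj_on_def)
  also have "\<dots> \<le> 1"
    using assms by (simp add: power_le_one)
  finally show ?thesis
    using \<open>0 < \<delta>\<close> by (simp add: field_simps)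
qed

text \<open>In probabilistic terms: \<open>Y\<close> is independent of the position of
  \<open>p\<close>, which is uniform among \<open>D\<close> places, and a point of the unit ball is
  large at no more than \<open>1 / \<delta>\<^sup>2\<close> of them.\<close>

lemma card_hits_resampled:
  fixes Y :: "(nat \<times> nat \<Rightarrow> nat) \<Rightarrow> vec"
  assumes I: "finite I" "p \<in> I" and \<delta>: "0 < \<delta>"
    and Y: "\<And>\<sigma>. norm (Y \<sigma>) \<le> 1" "\<And>\<sigma> v. Y (\<sigma>(p := v)) = Y \<sigma>"
  shows "real (card {\<sigma> \<in> I \<rightarrow>\<^sub>E {..<D}. \<delta> < \<bar>Poly_Mapping.lookup (Y \<sigma>) (scatter \<sigma> p)\<bar>}) * real D
           \<le> real (card (I \<rightarrow>\<^sub>E {..<D})) / \<delta>\<^sup>2"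
proof -
  let ?\<Omega> = "I \<rightarrow>\<^sub>E {..<D}"
  let ?hit = "\<lambda>\<sigma>. \<delta> < \<bar>Poly_Mapping.lookup (Y \<sigma>) (scatter \<sigma> p)\<bar>"
  have fin: "finite ?\<Omega>" using I by (intro finite_PiE) auto
  have upd: "\<sigma>(p := v) \<in> ?\<Omega>" if "\<sigma> \<in> ?\<Omega>" "v < D" for \<sigma> v
    using that I by (auto simp: PiE_iff extensional_def)
  have pD: "\<sigma> p < D" if "\<sigma> \<in> ?\<Omega>" for \<sigma>
    using that I by (auto simp: PiE_iff)
  have "real (card {\<sigma>\<in>?\<Omega>. ?hit \<sigma>}) * real D = (\<Sum>\<sigma>\<in>?\<Omega>. \<Sum>v<D. of_bool (?hit \<sigma>))"
    using fin by (simp add: sum_distrib_left sum_distrib_right[symmetric] Int_def mult.commute)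
  also have "\<dots> = (\<Sum>(\<sigma>, v)\<in>?\<Omega> \<times> {..<D}. of_bool (?hit \<sigma>))"
    by (rule sum.cartesian_product)
  \<comment> \<open>Exchanging \<open>\<sigma> p\<close> with \<open>v\<close> is an involution of
    the product, so the position of \<open>p\<close> may be replaced by a fresh one.\<close>
  also have "\<dots> = (\<Sum>(\<sigma>, v)\<in>?\<Omega> \<times> {..<D}. of_bool (?hit (\<sigma>(p := v))))"
    by (rule sum.reindex_bij_witness[of _ "\<lambda>(\<sigma>, v). (\<sigma>(p := v), \<sigma> p)" "\<lambda>(\<sigma>, v). (\<sigma>(p := v), \<sigma> p)"])
      (use upd pD in auto)
  also have "\<dots> = (\<Sum>\<sigma>\<in>?\<Omega>. \<Sum>v<D. of_bool (?hit (\<sigma>(p := v))))"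
    by (rule sum.cartesian_product[symmetric])
  also have "\<dots> \<le> (\<Sum>\<sigma>\<in>?\<Omega>. 1 / \<delta>\<^sup>2)"
  proof (rule sum_mono)
    fix \<sigma> assume "\<sigma> \<in> ?\<Omega>"
    have "(\<Sum>v<D. of_bool (?hit (\<sigma>(p := v)))) =
        real (card {v\<in>{..<D}. \<delta> < \<bar>Poly_Mapping.lookup (Y \<sigma>) (prod_encode (prod_encode p, v))\<bar>})"
      by (simp add: Y scatter_def Int_def)
    also have "\<dots> \<le> 1 / \<delta>\<^sup>2"
      using \<delta> Y by (intro card_large_coordinates) (auto simp: inj_def)
    finally show "(\<Sum>v<D. of_bool (?hit (\<sigma>(p := v)))) \<le> 1 / \<delta>\<^sup>2" .
  qed
  finally show ?thesis by simp
qed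

text \<open>A union bound over \<open>T + 1\<close> points and \<open>K * N\<close> links. Each pair
  is hit by a fraction of at most \<open>4 / (\<tau>\<^sup>2 * D)\<close> of the placements, and the
  bound on \<open>D\<close> makes the total at most a quarter. Outside the bad set
  \<open>answers_hidden\<close> applies.\<close>

lemma hidden_coordinates:
  fixes q :: "vec list \<Rightarrow> 'q" and pt :: "'q \<Rightarrow> vec" and out :: "vec list \<Rightarrow> vec"
    and comps :: "'q \<Rightarrow> nat set" and K N D T :: nat and a \<tau> M :: real
  defines "\<Omega> \<equiv> ({..<K} \<times> {..<N}) \<rightarrow>\<^sub>E {..<D}"
  defines "oracle \<equiv> \<lambda>\<sigma> x. energy_grad a \<tau> (scatter \<sigma>) M (comps x \<times> {..<N}) (pt x)"
  assumes \<tau>: "0 < \<tau>" and N: "0 < N"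
    and comps: "\<And>x. finite (comps x)"
    and pt: "\<And>as. norm (pt (q as)) \<le> 1" and out: "\<And>as. norm (out as) \<le> 1"
    and D: "16 * real (T + 1) * real (K * N) / \<tau>\<^sup>2 \<le> real D"
  shows "\<exists>Bad\<subseteq>\<Omega>. 4 * card Bad \<le> card \<Omega> \<and>
    (\<forall>\<sigma>\<in>\<Omega> - Bad. \<forall>i<K. visits comps (oracle \<sigma>) q i T < N \<longrightarrow>
      \<bar>Poly_Mapping.lookup (out (answers (oracle \<sigma>) q T)) (scatter \<sigma> (i, N - 1))\<bar> \<le> \<tau> / 2)"
proof -
  let ?I = "{..<K} \<times> {..<N}"
  define hidden where "hidden \<sigma> p x =
    energy_grad a \<tau> (scatter \<sigma>) M (comps x \<times> {..<N} - {fst p} \<times> {snd p..}) (pt x)" for \<sigma> p x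
  define probe where "probe t as = (if t < T then pt (q as) else out as)" for t as
  \<comment> \<open>The point at time \<open>t\<close> when the chain of \<open>p\<close> is cut off
    from \<open>p\<close> on, hence independent of \<open>\<sigma> p\<close>. Time \<open>T\<close>
    stands for the output.\<close>
  define Y where "Y t p \<sigma> = probe t (answers (hidden \<sigma> p) q t)" for t p \<sigma>
  define Hit where "Hit t p = {\<sigma>\<in>\<Omega>. \<tau> / 2 < \<bar>Poly_Mapping.lookup (Y t p \<sigma>) (scatter \<sigma> p)\<bar>}" for t p
  define Bad where "Bad = (\<Union>(t, p)\<in>{..T} \<times> ?I. Hit t p)"
  have norm_Y: "norm (Y t p \<sigma>) \<le> 1" for t p \<sigma>
    using pt out by (simp add: Y_def probe_def)
  have "hidden (\<sigma>(p := v)) p = hidden \<sigma> p" for \<sigma> p v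
    by (simp add: hidden_def fun_eq_iff scatter_upd energy_grad_hidden_upd)
  then have Y_upd: "Y t p (\<sigma>(p := v)) = Y t p \<sigma>" for t p \<sigma> v
    by (simp add: Y_def)
  have hit: "real (card (Hit t p)) * real D \<le> real (card \<Omega>) / (\<tau> / 2)\<^sup>2" if "p \<in> ?I" for t p
    unfolding Hit_def \<Omega>_def using that \<tau> norm_Y Y_upd by (intro card_hits_resampled) auto
  have "real (card Bad) \<le> (\<Sum>(t, p)\<in>{..T} \<times> ?I. real (card (Hit t p)))"
    unfolding Bad_def of_nat_sum[symmetric] case_prod_beta
    by (intro of_nat_mono card_UN_le) auto
  then have "real (card Bad) * real D \<le> (\<Sum>(t, p)\<in>{..T} \<times> ?I. real (card (Hit t p)) * real D)"
    by (simp add: case_prod_beta sum_distrib_right[symmetric] mult_right_mono)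
  also have "\<dots> \<le> (\<Sum>(t, p)\<in>{..T} \<times> ?I. real (card \<Omega>) / (\<tau> / 2)\<^sup>2)"
    using hit by (intro sum_mono) auto
  also have "\<dots> = (16 * real (T + 1) * real (K * N) / \<tau>\<^sup>2) * real (card \<Omega>) / 4"
    using \<tau> by (simp add: field_simps power2_eq_square)
  also have "\<dots> \<le> real D * real (card \<Omega>) / 4"
    using D by (intro divide_right_mono mult_right_mono) auto
  finally have *: "real (card Bad) * real D \<le> real D * real (card \<Omega>) / 4" .
  have card_Bad: "4 * card Bad \<le> card \<Omega>"
  \<comment> \<open>For \<open>K = 0\<close> the bound on \<open>D\<close> does not force
    \<open>D\<close> to be positive, but there is no link to hit.\<close>
  proof (cases "K = 0")
    case True
    then show ?thesis by (simp add: Bad_def)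
  next
    case False
    then have "0 < 16 * real (T + 1) * real (K * N) / \<tau>\<^sup>2" using \<tau> N by simp
    then have "0 < real D" using D by linarith
    then have "real (4 * card Bad) \<le> real (card \<Omega>)" using * by (simp add: field_simps)
    then show ?thesis by linarith
  qed
  have "\<bar>Poly_Mapping.lookup (out (answers (oracle \<sigma>) q T)) (scatter \<sigma> (i, N - 1))\<bar> \<le> \<tau> / 2"
    if \<sigma>: "\<sigma> \<in> \<Omega> - Bad" and i: "i < K" and v: "visits comps (oracle \<sigma>) q i T < N" for \<sigma> i
  proof -
    have small: "\<bar>Poly_Mapping.lookup (Y t (k, l) \<sigma>) (scatter \<sigma> (k, l))\<bar> \<le> \<tau> / 2"
      if "t \<le> T" "k < K" "l < N" for t k l
      using \<sigma> that by (force simp: Bad_def Hit_def not_less)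
    \<comment> \<open>Fewer than \<open>N\<close> visits means at most \<open>N - 1\<close>, which
      leaves the last link hidden.\<close>
    have "answers (oracle \<sigma>) q T = answers (hidden \<sigma> (i, N - 1)) q T"
    proof (rule answers_hidden[where T = T and K = K and N = N and comps = comps and
          quiet = "\<lambda>p x. \<bar>Poly_Mapping.lookup (pt x) (scatter \<sigma> p)\<bar> \<le> \<tau> / 2"])
      fix u k l assume "u < T" "k < K" "l < N"
      then show "\<bar>Poly_Mapping.lookup (pt (q (answers (hidden \<sigma> (k, l)) q u))) (scatter \<sigma> (k, l))\<bar> \<le> \<tau> / 2"
        using small[of u k l] by (simp add: Y_def probe_def)
    next
      fix k j x
      assume "k \<in> comps x \<Longrightarrow> 0 < j \<and> (\<forall>l. j - 1 \<le> l \<longrightarrow> l < N \<longrightarrow>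
        \<bar>Poly_Mapping.lookup (pt x) (scatter \<sigma> (k, l))\<bar> \<le> \<tau> / 2)"
      moreover have "comps x \<times> {..<N} - {k} \<times> {j..} = comps x \<times> {..<N}" if "k \<notin> comps x"
        using that by auto
      ultimately show "oracle \<sigma> x = hidden \<sigma> (k, j) x"
        using energy_grad_remove_quiet[of j N "pt x" "scatter \<sigma>" k \<tau> "comps x"] comps
        unfolding oracle_def hidden_def by (cases "k \<in> comps x") auto
    qed (use v i N in auto)
    then show ?thesis
      using small[of T i "N - 1"] i N
      by (simp add: Y_def probe_def)
  qed
  moreover have "Bad \<subseteq> \<Omega>" by (auto simp: Bad_def Hit_def)
  ultimately show ?thesis using card_Bad by blast
qed

section \<open>Lower bounds on the error\<close>

text \<open>The descents telescope from \<open>a\<close> to the last coordinate. The dead zones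
  absorb \<open>a / 4\<close> in total and the last coordinate is at most \<open>a / 8\<close>, so
  the excesses sum to at least \<open>a / 2\<close>; Cauchy-Schwarz over \<open>N\<close> links
  bounds their squares.\<close>

lemma chain_energy_ge:
  assumes "0 < a" "0 < N" and \<tau>: "\<tau> = a / (4 * real N)"
    and last: "\<bar>Poly_Mapping.lookup x (\<pi> (i, N - 1))\<bar> \<le> \<tau> / 2"
  shows "a\<^sup>2 / (8 * real N) \<le> (\<Sum>j<N. (excess a \<tau> \<pi> (i, j) x)\<^sup>2 / 2)"
proof -
  let ?y = "\<lambda>j. Poly_Mapping.lookup x (\<pi> (i, j))" and ?e = "\<lambda>j. excess a \<tau> \<pi> (i, j) x"
  have "(\<Sum>j<Suc n. (if j = 0 then a else ?y (j - 1)) - ?y j - \<tau>) = a - ?y n - real (Suc n) * \<tau>" for n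
    by (induction n) (simp_all add: algebra_simps)
  from this[of "N - 1"] have "(\<Sum>j<N. (if j = 0 then a else ?y (j - 1)) - ?y j - \<tau>) = a - ?y (N - 1) - real N * \<tau>"
    using \<open>0 < N\<close> by simp
  moreover have "(\<Sum>j<N. (if j = 0 then a else ?y (j - 1)) - ?y j - \<tau>) \<le> (\<Sum>j<N. ?e j)"
    by (intro sum_mono) (simp add: excess_eq)
  moreover have "real N * \<tau> = a / 4" using \<open>0 < N\<close> by (simp add: \<tau>)
  moreover have "\<tau> \<le> a / 4"
    unfolding \<tau> using assms by (intro divide_left_mono) auto
  ultimately have "a / 2 \<le> (\<Sum>j<N. ?e j)"
    using last \<open>0 < a\<close> by linarith
  then have "(a / 2)\<^sup>2 \<le> (\<Sum>j<N. ?e j)\<^sup>2"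
    using \<open>0 < a\<close> by (intro power_mono) auto
  also have "\<dots> \<le> (\<Sum>j<N. (?e j)\<^sup>2) * real N"
    using Cauchy_Schwarz_ineq_sum[of ?e "\<lambda>_. 1" "{..<N}"] by simp
  finally have "a\<^sup>2 \<le> 4 * ((\<Sum>j<N. (?e j)\<^sup>2) * real N)"
    by (simp add: power_divide)
  then show ?thesis
    using \<open>0 < N\<close> by (simp add: sum_divide_distrib[symmetric] field_simps)
qed

lemma energy_nonneg: "0 \<le> M \<Longrightarrow> 0 \<le> energy a \<tau> \<pi> M J x"
  by (simp add: energy_def sum_nonneg)

lemma energy_ge:
  assumes "0 < a" "0 < N" "\<tau> = a / (4 * real N)" "0 \<le> M" "finite I" "G \<subseteq> I"
    and "\<And>i. i \<in> G \<Longrightarrow> \<bar>Poly_Mapping.lookup x (\<pi> (i, N - 1))\<bar> \<le> \<tau> / 2"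
  shows "M * (real (card G) * (a\<^sup>2 / (8 * real N))) \<le> energy a \<tau> \<pi> M (I \<times> {..<N}) x"
proof -
  let ?c = "\<lambda>i. \<Sum>j<N. (excess a \<tau> \<pi> (i, j) x)\<^sup>2 / 2"
  have "real (card G) * (a\<^sup>2 / (8 * real N)) = (\<Sum>i\<in>G. a\<^sup>2 / (8 * real N))" by simp
  also have "\<dots> \<le> (\<Sum>i\<in>G. ?c i)"
    using assms by (intro sum_mono chain_energy_ge) auto
  also have "\<dots> \<le> (\<Sum>i\<in>I. ?c i)"
    using assms by (intro sum_mono2 sum_nonneg) auto
  also have "\<dots> = (\<Sum>p\<in>I \<times> {..<N}. (excess a \<tau> \<pi> p x)\<^sup>2 / 2)"
    unfolding sum.cartesian_product by (simp add: case_prod_beta)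
  finally show ?thesis
    unfolding energy_def using \<open>0 \<le> M\<close> by (intro mult_left_mono)
qed

lemma abs_lookup_le_norm: "\<bar>Poly_Mapping.lookup x k\<bar> \<le> norm (x :: vec)"
proof -
  have "(Poly_Mapping.lookup x k)\<^sup>2 \<le> (norm x)\<^sup>2"
    using sum_lookup_squares_le[of "{k}" id x] by simp
  then show ?thesis
    using abs_le_square_iff[of "Poly_Mapping.lookup x k" "norm x"] by simp
qed

text \<open>A crude bound, enough to make the error integrable over the seed.\<close>

lemma energy_le:
  assumes "0 \<le> M" "0 \<le> a" "0 \<le> \<tau>" "norm x \<le> 1"
  shows "energy a \<tau> \<pi> M J x \<le> M * (real (card J) * ((a + 2)\<^sup>2 / 2))"
proof -
  have "excess a \<tau> \<pi> p x \<le> a + 2" for p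
  proof (cases p)
    case (Pair i j)
    have y: "\<bar>Poly_Mapping.lookup x k\<bar> \<le> 1" for k
      using abs_lookup_le_norm[of x k] assms by linarith
    show ?thesis
      using y[of "\<pi> (i, j)"] y[of "\<pi> (i, j - 1)"] assms unfolding Pair excess_eq by auto
  qed
  then have "(\<Sum>p\<in>J. (excess a \<tau> \<pi> p x)\<^sup>2 / 2) \<le> (\<Sum>p\<in>J. (a + 2)\<^sup>2 / 2)"
    by (intro sum_mono divide_right_mono power_mono excess_nonneg) auto
  then show ?thesis
    unfolding energy_def using \<open>0 \<le> M\<close> by (intro mult_left_mono) auto
qed

text \<open>The witness equals \<open>a\<close> at every chain coordinate: no link descends,
  including the first one, which starts from \<open>a\<close>.\<close>

lemma flat_point:
  assumes "finite I" "inj_on \<pi> (I \<times> {..<N})" "\<pi> ` (I \<times> {..<N}) \<subseteq> {..<d}" "0 \<le> \<tau>"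
  obtains z where "z \<in> Rd d" "(norm z)\<^sup>2 = real (card I * N) * a\<^sup>2"
    "energy a \<tau> \<pi> M (I \<times> {..<N}) z = 0"
proof
  let ?J = "I \<times> {..<N}"
  define z :: vec where "z = (\<Sum>p\<in>?J. a *\<^sub>R Poly_Mapping.single (\<pi> p) 1)"
  show "z \<in> Rd d"
    unfolding z_def using assms(3)
    by (intro subspace_sum[OF subspace_Rd] scaleR_in_Rd) (auto simp: Rd_def image_subset_iff)
  have lookup_z: "Poly_Mapping.lookup z (\<pi> r) = a" if r: "r \<in> ?J" for r
  proof -
    have "Poly_Mapping.lookup z (\<pi> r) = (\<Sum>p\<in>?J. if p = r then a else 0)"
      unfolding z_def lookup_sum
      by (rule sum.cong) (use assms(2) r in \<open>auto simp: lookup_single when_def inj_on_eq_iff\<close>)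
    then show ?thesis using r \<open>finite I\<close> by simp
  qed
  have "(norm z)\<^sup>2 = (\<Sum>p\<in>?J. a * Poly_Mapping.lookup z (\<pi> p))"
    by (subst power2_norm_eq_inner, subst z_def) (simp add: inner_sum_left inner_single_left)
  then show "(norm z)\<^sup>2 = real (card I * N) * a\<^sup>2"
    using lookup_z by (simp add: power2_eq_square card_cartesian_product)
  have "excess a \<tau> \<pi> (i, j) z = 0" if "(i, j) \<in> ?J" for i j
    using lookup_z[of "(i, j)"] lookup_z[of "(i, j - 1)"] that \<open>0 \<le> \<tau>\<close> by (auto simp: excess_eq)
  then show "energy a \<tau> \<pi> M ?J z = 0"
    by (auto simp: energy_def intro!: sum.neutral)
qed

lemma avg_energy:
  "avg K (\<lambda>i. energy a \<tau> \<pi> M ({i} \<times> {..<N})) = energy a \<tau> \<pi> (M / real K) ({..<K} \<times> {..<N})"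
proof
  fix x
  have "(\<Sum>i<K. energy a \<tau> \<pi> M ({i} \<times> {..<N}) x) =
      (\<Sum>i<K. \<Sum>j<N. M * ((excess a \<tau> \<pi> (i, j) x)\<^sup>2 / 2))"
    unfolding energy_def sum.cartesian_product' by (simp add: sum_distrib_left)
  also have "\<dots> = M * (\<Sum>p\<in>{..<K} \<times> {..<N}. (excess a \<tau> \<pi> p x)\<^sup>2 / 2)"
    unfolding sum.cartesian_product' sum_distrib_left ..
  finally show "avg K (\<lambda>i. energy a \<tau> \<pi> M ({i} \<times> {..<N})) x = energy a \<tau> \<pi> (M / real K) ({..<K} \<times> {..<N}) x"
    by (simp add: avg_def energy_def)
qed

section \<open>Counting visits and averaging over the seed\<close>

lemma visits_le: "visits comps oracle q i t \<le> t"
  by (induction t) (simp_all add: visits_Suc visits_def[of _ _ _ _ 0])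

lemma sum_visits:
  assumes "\<And>as. fst (q as) < K"
  shows "(\<Sum>i<K. visits (\<lambda>x. {fst x}) oracle q i t) = t"
proof (induction t)
  case 0
  then show ?case by (simp add: visits_def)
next
  case (Suc t)
  then show ?case using assms by (simp add: visits_Suc sum.distrib)
qed

text \<open>Markov's inequality: each remaining component takes at least \<open>2 * s\<close> of at
  most \<open>s * K\<close> visits.\<close>

lemma half_of_components_rarely_visited:
  fixes v :: "nat \<Rightarrow> nat"
  assumes "(\<Sum>i<K. v i) \<le> s * K" "1 \<le> s"
  shows "K \<le> 2 * card {i\<in>{..<K}. v i < 2 * s}"
proof -
  let ?G = "{i\<in>{..<K}. v i < 2 * s}"
  have "2 * s * card ({..<K} - ?G) = (\<Sum>i\<in>{..<K} - ?G. 2 * s)" by simp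
  also have "\<dots> \<le> (\<Sum>i\<in>{..<K} - ?G. v i)" by (intro sum_mono) auto
  also have "\<dots> \<le> (\<Sum>i<K. v i)" by (intro sum_mono2) auto
  finally have "2 * s * card ({..<K} - ?G) \<le> s * K" using assms(1) by linarith
  then have "s * (2 * card ({..<K} - ?G)) \<le> s * K" by (simp only: mult_ac)
  then have "2 * card ({..<K} - ?G) \<le> K" using assms by simp
  moreover have "card ({..<K} - ?G) = K - card ?G"
    by (subst card_Diff_subset) auto
  ultimately show ?thesis by linarith
qed

text \<open>The exceptional set \<open>B\<close> depends on \<open>w\<close>, so no single choice is
  good for all \<open>w\<close>. But for each \<open>w\<close> at least half of \<Omega> avoids both
  \<open>B\<close> and \<open>Bad\<close>; summing over \<open>\<Omega> - Bad\<close> and exchanging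
  sum and expectation yields a choice with a large mean.\<close>

lemma (in prob_space) exists_large_expectation:
  fixes g :: "'i \<Rightarrow> 'a \<Rightarrow> real"
  assumes fin: "finite \<Omega>" "0 < card \<Omega>"
    and bad: "Bad \<subseteq> \<Omega>" "4 * card Bad \<le> card \<Omega>"
    and int: "\<And>\<sigma>. \<sigma> \<in> \<Omega> \<Longrightarrow> integrable M (g \<sigma>)" and nonneg: "\<And>\<sigma> w. 0 \<le> g \<sigma> w" and "0 \<le> \<eta>"
    and large: "\<And>w. w \<in> space M \<Longrightarrow>
      \<exists>B\<subseteq>\<Omega>. 4 * card B \<le> card \<Omega> \<and> (\<forall>\<sigma>\<in>\<Omega> - B. \<eta> \<le> g \<sigma> w)"
  shows "\<exists>\<sigma>\<in>\<Omega> - Bad. \<eta> / 2 \<le> expectation (g \<sigma>)"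
proof (rule ccontr)
  assume contr: "\<not> ?thesis"
  have card_bad: "card (\<Omega> - Bad) = card \<Omega> - card Bad"
    using bad fin by (intro card_Diff_subset) (auto intro: finite_subset)
  have pointwise: "\<eta> * (real (card \<Omega>) / 2) \<le> (\<Sum>\<sigma>\<in>\<Omega> - Bad. g \<sigma> w)" if "w \<in> space M" for w
  proof -
    obtain B where B: "B \<subseteq> \<Omega>" "4 * card B \<le> card \<Omega>" "\<And>\<sigma>. \<sigma> \<in> \<Omega> - B \<Longrightarrow> \<eta> \<le> g \<sigma> w"
      using large[OF \<open>w \<in> space M\<close>] by blast
    have "card \<Omega> \<le> card (\<Omega> - Bad - B) + card Bad + card B"
    proof -
      have "\<Omega> \<subseteq> (\<Omega> - Bad - B) \<union> Bad \<union> B" by auto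
      then have "card \<Omega> \<le> card ((\<Omega> - Bad - B) \<union> Bad \<union> B)"
        using fin bad B by (intro card_mono) (auto intro: finite_subset)
      also have "\<dots> \<le> card (\<Omega> - Bad - B) + card Bad + card B"
        by (meson card_Un_le add_le_mono1 order_trans)
      finally show ?thesis .
    qed
    then have "real (card \<Omega>) / 2 \<le> real (card (\<Omega> - Bad - B))"
      using bad B by linarith
    then have "\<eta> * (real (card \<Omega>) / 2) \<le> \<eta> * real (card (\<Omega> - Bad - B))"
      using \<open>0 \<le> \<eta>\<close> by (rule mult_left_mono)
    also have "\<dots> = (\<Sum>\<sigma>\<in>\<Omega> - Bad - B. \<eta>)" by simp
    also have "\<dots> \<le> (\<Sum>\<sigma>\<in>\<Omega> - Bad - B. g \<sigma> w)"
      using B by (intro sum_mono) auto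
    also have "\<dots> \<le> (\<Sum>\<sigma>\<in>\<Omega> - Bad. g \<sigma> w)"
      using fin nonneg by (intro sum_mono2) auto
    finally show ?thesis .
  qed
  have "\<eta> * (real (card \<Omega>) / 2) \<le> expectation (\<lambda>w. \<Sum>\<sigma>\<in>\<Omega> - Bad. g \<sigma> w)"
    using int pointwise by (intro integral_ge_const) (auto intro!: AE_I2)
  also have "\<dots> = (\<Sum>\<sigma>\<in>\<Omega> - Bad. expectation (g \<sigma>))"
    using int by (intro Bochner_Integration.integral_sum) auto
  also have "\<dots> < (\<Sum>\<sigma>\<in>\<Omega> - Bad. \<eta> / 2)"
    using contr fin bad card_bad
    by (intro sum_strict_mono) (auto simp: not_le)
  also have "\<dots> \<le> \<eta> * (real (card \<Omega>) / 2)"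
    using \<open>0 \<le> \<eta>\<close> card_bad by (simp add: mult.commute mult_left_mono)
  finally show False by simp
qed

section \<open>The hard instance\<close>

lemma norm_unit_ball: "x \<in> unit_ball d \<Longrightarrow> norm x \<le> 1"
  by (simp add: unit_ball_def abs_square_le_1)

lemma continuous_energy: "continuous_on UNIV (energy a \<tau> \<pi> M J)"
  by (rule has_derivative_continuous_on) (rule energy_has_derivative)

lemma min_value_eq_0:
  assumes "z \<in> X" "f z = 0" "\<And>x. 0 \<le> f x"
  shows "min_value X f = 0" "is_arg_min f (\<lambda>x. x \<in> X) z"
proof -
  show "min_value X f = 0"
    unfolding min_value_def by (rule cInf_eq_minimum) (use assms in auto)
  show "is_arg_min f (\<lambda>x. x \<in> X) z"
    using assms by (simp add: is_arg_min_def not_less)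
qed

text \<open>For each seed, the error of the stochastic method is large on three quarters of the
  coordinate choices, and the deterministic one misses the minimiser on three quarters of them, so some
  choice serves for both.  The strict positivity of the error of the deterministic method is
  what keeps the quotient of the theorem away from \<open>x / 0 = 0\<close>.\<close>

lemma hard_instance:
  fixes A_full :: full_method and A_stoch :: "'w stoch_method"
  assumes full: "deterministic_gradient_method A_full"
    and stoch: "stochastic_gradient_method A_stoch"
    and s: "1 \<le> s" and K: "1 \<le> K" and Lb: "0 < Lb" and Lf: "0 < Lf" and LbLf: "Lb \<le> real K * Lf"
  shows "\<forall>\<^sub>F d in sequentially. \<forall>x0\<in>unit_ball d. \<exists>fs z.
    (\<forall>i<K. fs i \<in> F11 d (unit_ball d) Lb) \<and> avg K fs \<in> F11 d (unit_ball d) Lf \<and>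
    z \<in> unit_ball d \<and> avg K fs z = 0 \<and> (\<forall>x. 0 \<le> avg K fs x) \<and>
    0 < avg K fs (full_iterate A_full d Lf x0 (avg K fs) s) \<and>
    Lb / (512 * real K * (real s)\<^sup>2) \<le> expected_value A_stoch d K Lb Lf x0 fs s"
proof -
  \<comment> \<open>Twice the average number of visits per component, so at least half of the chains
    are not explored to the end; \<open>s\<close> full gradients finish no chain at all.\<close>
  define N where "N = 2 * s"
  \<comment> \<open>Normalised so that the flat point, with \<open>K * N\<close> coordinates equal
    to \<open>a\<close>, has norm 1.\<close>
  define a where "a = 1 / sqrt (real (K * N))"
  define \<tau> where "\<tau> = a / (4 * real N)"
  have N: "0 < N" using s by (simp add: N_def)
  have a: "0 < a" using K N by (simp add: a_def)
  have a2: "real (K * N) * a\<^sup>2 = 1" using K N by (simp add: a_def power_divide)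
  have \<tau>: "0 < \<tau>" using a N by (simp add: \<tau>_def)
  obtain D :: nat where D: "16 * real (s * K + 1) * real (K * N) / \<tau>\<^sup>2 \<le> real D"
    using real_arch_simple by blast
  have "0 < 16 * real (s * K + 1) * real (K * N) / \<tau>\<^sup>2"
    using \<tau> K N by (intro divide_pos_pos mult_pos_pos) (simp_all only: of_nat_0_less_iff, auto)
  then have D0: "0 < D" using D by (metis less_le_trans of_nat_0_less_iff)
  have D': "16 * real (s + 1) * real (K * N) / \<tau>\<^sup>2 \<le> real D"
  proof -
    have "s \<le> s * K" using K by simp
    then have "real s \<le> real (s * K)" by (simp only: of_nat_le_iff)
    then have "16 * real (s + 1) * real (K * N) / \<tau>\<^sup>2 \<le> 16 * real (s * K + 1) * real (K * N) / \<tau>\<^sup>2"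
      by (intro divide_right_mono mult_right_mono mult_left_mono) auto
    with D show ?thesis by linarith
  qed
  define I where "I = {..<K} \<times> {..<N}"
  define \<Omega> where "\<Omega> = I \<rightarrow>\<^sub>E {..<D}"
  have fin\<Omega>: "finite \<Omega>" unfolding \<Omega>_def I_def by (intro finite_PiE) auto
  have card\<Omega>: "0 < card \<Omega>" using D0 by (simp add: \<Omega>_def I_def card_PiE)
  \<comment> \<open>Beyond every coordinate that any placement uses, so the threshold for
    \<open>d\<close> is independent of \<open>x0\<close>.\<close>
  define d0 where "d0 = Suc (Max (insert 0 (\<Union>\<sigma>\<in>\<Omega>. scatter \<sigma> ` I)))"
  have scatter_less: "scatter \<sigma> p < d" if "\<sigma> \<in> \<Omega>" "p \<in> I" "d0 \<le> d" for \<sigma> p d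
  proof -
    have "scatter \<sigma> p \<le> Max (insert 0 (\<Union>\<sigma>\<in>\<Omega>. scatter \<sigma> ` I))"
      using that fin\<Omega> by (intro Max_ge) (auto simp: I_def)
    with that show ?thesis by (simp add: d0_def)
  qed
  \<comment> \<open>The factor \<open>Lb / 4\<close> cancels the 4 of
    \<open>energy_grad_lipschitz\<close>. For the average, \<open>F\<close>, the same computation
    gives \<open>Lb / real K\<close>, which is at most \<open>Lf\<close>.\<close>
  define fs where "fs \<sigma> i = energy a \<tau> (scatter \<sigma>) (Lb / 4) ({i} \<times> {..<N})" for \<sigma> i
  define F where "F \<sigma> = energy a \<tau> (scatter \<sigma>) (Lb / 4 / real K) ({..<K} \<times> {..<N})" for \<sigma>
  have avg: "avg K (fs \<sigma>) = F \<sigma>" for \<sigma>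
    unfolding fs_def F_def by (rule avg_energy)
  have F_nonneg: "0 \<le> F \<sigma> x" for \<sigma> x
    unfolding F_def using Lb by (intro energy_nonneg) simp
  have inj: "inj_on (scatter \<sigma>) A" for \<sigma> A
    using inj_scatter by (rule inj_on_subset) simp
  \<comment> \<open>The energy of \<open>K / 2\<close> unfinished chains with weight
    \<open>Lb / 4 / real K\<close>, using \<open>a\<^sup>2 = 1 / (2 * K * s)\<close>.\<close>
  define \<eta> where "\<eta> = Lb / (256 * real K * (real s)\<^sup>2)"
  show ?thesis
  proof (rule eventually_sequentiallyI[of d0], rule ballI)
    fix d and x0 :: vec
    assume d: "d0 \<le> d" and x0: "x0 \<in> unit_ball d"
    let ?X = "unit_ball d"
    have img: "scatter \<sigma> ` (A \<times> {..<N}) \<subseteq> {..<d}" if "\<sigma> \<in> \<Omega>" "A \<subseteq> {..<K}" for \<sigma> A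
      using scatter_less[OF that(1) _ d] that(2) by (auto simp: I_def)
    have fs_F11: "fs \<sigma> i \<in> F11 d ?X Lb" if "\<sigma> \<in> \<Omega>" "i < K" for \<sigma> i
      unfolding fs_def using that Lb by (intro energy_in_F11 inj img) auto
    have F_F11: "F \<sigma> \<in> F11 d ?X Lf" if "\<sigma> \<in> \<Omega>" for \<sigma>
      unfolding F_def using that Lb LbLf K
      by (intro energy_in_F11 inj img) (auto simp: field_simps)
    have pt_full: "full_query A_full d Lf x0 as \<in> ?X" "full_output A_full d Lf x0 as \<in> ?X" for as
      using full Lf x0 by (auto simp: deterministic_gradient_method_def)
    note norm_full = pt_full[THEN norm_unit_ball]
    obtain Bad where Bad: "Bad \<subseteq> \<Omega>" "4 * card Bad \<le> card \<Omega>"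
      and miss: "\<And>\<sigma> i. \<sigma> \<in> \<Omega> - Bad \<Longrightarrow> i < K \<Longrightarrow>
        visits (\<lambda>_. {..<K}) (energy_grad a \<tau> (scatter \<sigma>) (Lb / 4 / real K) ({..<K} \<times> {..<N}))
           (full_query A_full d Lf x0) i s < N \<Longrightarrow>
        \<bar>Poly_Mapping.lookup (full_output A_full d Lf x0 (answers
           (energy_grad a \<tau> (scatter \<sigma>) (Lb / 4 / real K) ({..<K} \<times> {..<N}))
           (full_query A_full d Lf x0) s)) (scatter \<sigma> (i, N - 1))\<bar> \<le> \<tau> / 2"
      using hidden_coordinates[where comps = "\<lambda>_. {..<K}" and pt = "\<lambda>x. x"
          and q = "full_query A_full d Lf x0" and out = "full_output A_full d Lf x0" and a = a
          and M = "Lb / 4 / real K", OF \<tau> N finite_lessThan norm_full D', folded \<Omega>_def[unfolded I_def]]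
      by blast
    have full_pos: "0 < F \<sigma> (full_iterate A_full d Lf x0 (F \<sigma>) s)" if \<sigma>: "\<sigma> \<in> \<Omega> - Bad" for \<sigma>
    proof -
      let ?x = "full_iterate A_full d Lf x0 (F \<sigma>) s"
      have "visits (\<lambda>_. {..<K}) orc q i s < N" for i and orc :: "vec \<Rightarrow> vec" and q
        using visits_le[of "\<lambda>_. {..<K}" orc q i s] s by (simp add: N_def)
      then have "\<bar>Poly_Mapping.lookup (full_output A_full d Lf x0 (answers
           (energy_grad a \<tau> (scatter \<sigma>) (Lb / 4 / real K) ({..<K} \<times> {..<N}))
           (full_query A_full d Lf x0) s)) (scatter \<sigma> (i, N - 1))\<bar> \<le> \<tau> / 2" if "i < K" for i
        using miss[OF \<sigma> that] by blast
      \<comment> \<open>\<open>grad_energy\<close> needs points of the ball, and the method queries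
        only such points.\<close>
      moreover have "answers (grad d ?X (F \<sigma>)) (full_query A_full d Lf x0) s = answers
           (energy_grad a \<tau> (scatter \<sigma>) (Lb / 4 / real K) ({..<K} \<times> {..<N}))
           (full_query A_full d Lf x0) s"
        unfolding F_def using \<sigma> pt_full by (intro answers_cong grad_energy img) auto
      ultimately have "Lb / 4 / real K * (real (card {..<K}) * (a\<^sup>2 / (8 * real N))) \<le> F \<sigma> ?x"
        unfolding F_def using a N \<tau>_def Lb
        by (intro energy_ge) (auto simp: full_iterate_def F_def)
      moreover have "0 < Lb / 4 / real K * (real (card {..<K}) * (a\<^sup>2 / (8 * real N)))"
        using Lb K a N by simp
      ultimately show ?thesis by linarith
    qed
    interpret P: prob_space "seed A_stoch"
      using stoch by (simp add: stochastic_gradient_method_def)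
    let ?q = "stoch_query A_stoch d K Lb Lf x0" and ?out = "stoch_output A_stoch d K Lb Lf x0"
    let ?it = "\<lambda>\<sigma>. stoch_iterate A_stoch d K Lb Lf x0 (fs \<sigma>) s"
    have pt: "?q w as \<in> {..<K} \<times> ?X" "?out w as \<in> ?X" if "w \<in> space (seed A_stoch)" for w as
      using stoch K Lb Lf x0 that unfolding stochastic_gradient_method_def by blast+
    have F_it_le: "norm (F \<sigma> (?it \<sigma> w)) \<le> Lb / 4 / real K * (real (card ({..<K} \<times> {..<N})) * ((a + 2)\<^sup>2 / 2))"
      if "w \<in> space (seed A_stoch)" for \<sigma> w
    proof -
      have "norm (?it \<sigma> w) \<le> 1"
        using pt(2)[OF that] by (auto simp: stoch_iterate_def intro: norm_unit_ball)
      then show ?thesis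
        unfolding real_norm_def abs_of_nonneg[OF F_nonneg] unfolding F_def
        using a \<tau> Lb by (intro energy_le) auto
    qed
    have integrable: "integrable (seed A_stoch) (\<lambda>w. F \<sigma> (?it \<sigma> w))" if \<sigma>: "\<sigma> \<in> \<Omega>" for \<sigma>
    proof (rule P.integrable_const_bound)
      show "AE w in seed A_stoch. norm (F \<sigma> (?it \<sigma> w))
          \<le> Lb / 4 / real K * (real (card ({..<K} \<times> {..<N})) * ((a + 2)\<^sup>2 / 2))"
        using F_it_le by (intro AE_I2)
      have "finite_sum_instance d K Lb Lf (fs \<sigma>)"
        using fs_F11 F_F11 \<sigma> by (simp add: finite_sum_instance_def avg)
      then have "?it \<sigma> \<in> measurable (seed A_stoch) borel"
        using stoch K Lb Lf x0 by (simp add: stochastic_gradient_method_def)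
      moreover have "F \<sigma> \<in> borel_measurable borel"
        unfolding F_def by (intro borel_measurable_continuous_onI continuous_energy)
      ultimately show "(\<lambda>w. F \<sigma> (?it \<sigma> w)) \<in> borel_measurable (seed A_stoch)"
        by (rule measurable_compose)
    qed
    \<comment> \<open>Once the seed \<open>w\<close> is fixed, the stochastic method is
      deterministic and \<open>hidden_coordinates\<close> applies to it.\<close>
    have large: "\<exists>B\<subseteq>\<Omega>. 4 * card B \<le> card \<Omega> \<and> (\<forall>\<sigma>\<in>\<Omega> - B. \<eta> \<le> F \<sigma> (?it \<sigma> w))"
      if w: "w \<in> space (seed A_stoch)" for w
    proof -
      define orc where "orc \<sigma> x = energy_grad a \<tau> (scatter \<sigma>) (Lb / 4) ({fst x} \<times> {..<N}) (snd x)"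
        for \<sigma> and x :: "nat \<times> vec"
      have q: "fst (?q w as) < K" "snd (?q w as) \<in> ?X" for as
        using pt(1)[OF w, of as] by (auto simp: mem_Times_iff)
      note norm_stoch = q(2)[THEN norm_unit_ball] pt(2)[OF w, THEN norm_unit_ball]
      have fin_comps: "finite {fst x}" for x :: "nat \<times> vec" by simp
      obtain B where B: "B \<subseteq> \<Omega>" "4 * card B \<le> card \<Omega>"
        and miss: "\<And>\<sigma> i. \<sigma> \<in> \<Omega> - B \<Longrightarrow> i < K \<Longrightarrow>
          visits (\<lambda>x. {fst x}) (orc \<sigma>) (?q w) i (s * K) < N \<Longrightarrow>
          \<bar>Poly_Mapping.lookup (?out w (answers (orc \<sigma>) (?q w) (s * K))) (scatter \<sigma> (i, N - 1))\<bar> \<le> \<tau> / 2"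
        using hidden_coordinates[where comps = "\<lambda>x. {fst x}" and pt = snd and q = "?q w"
            and out = "?out w" and a = a and M = "Lb / 4", OF \<tau> N fin_comps norm_stoch D,
            folded \<Omega>_def[unfolded I_def] orc_def]
        by blast
      have "\<eta> \<le> F \<sigma> (?it \<sigma> w)" if \<sigma>: "\<sigma> \<in> \<Omega> - B" for \<sigma>
      proof -
        let ?v = "\<lambda>i. visits (\<lambda>x. {fst x}) (orc \<sigma>) (?q w) i (s * K)"
        let ?G = "{i\<in>{..<K}. ?v i < N}"
        have "K \<le> 2 * card ?G"
          unfolding N_def using s sum_visits[OF q(1)]
          by (intro half_of_components_rarely_visited) simp_all
        then have G: "real K / 2 \<le> real (card ?G)" by linarith
        have "answers (\<lambda>(i, y). grad d ?X (fs \<sigma> i) y) (?q w) (s * K) = answers (orc \<sigma>) (?q w) (s * K)"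
        proof (rule answers_cong)
          fix as
          have "grad d ?X (fs \<sigma> (fst (?q w as))) (snd (?q w as)) = orc \<sigma> (?q w as)"
            unfolding fs_def orc_def using \<sigma> q by (intro grad_energy img) auto
          then show "(case ?q w as of (i, y) \<Rightarrow> grad d ?X (fs \<sigma> i) y) = orc \<sigma> (?q w as)"
            by (simp add: case_prod_beta)
        qed
        then have it: "?it \<sigma> w = ?out w (answers (orc \<sigma>) (?q w) (s * K))"
          by (simp add: stoch_iterate_def)
        have "\<eta> = Lb / 4 / real K * (real K / 2 * (a\<^sup>2 / (8 * real N)))"
        proof -
          have "a\<^sup>2 = 1 / (real K * (2 * real s))" using a2 K s by (simp add: N_def field_simps)
          then show ?thesis using K s by (simp add: \<eta>_def N_def field_simps power2_eq_square)
        qed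
        also have "\<dots> \<le> Lb / 4 / real K * (real (card ?G) * (a\<^sup>2 / (8 * real N)))"
          using G Lb by (intro mult_left_mono mult_right_mono) auto
        also have "\<dots> \<le> F \<sigma> (?it \<sigma> w)"
          unfolding F_def it using a N \<tau>_def Lb miss[OF \<sigma>] by (intro energy_ge) auto
        finally show ?thesis .
      qed
      with B show ?thesis by blast
    qed
    have "0 \<le> \<eta>" using Lb by (simp add: \<eta>_def)
    obtain \<sigma> where \<sigma>: "\<sigma> \<in> \<Omega> - Bad" "\<eta> / 2 \<le> P.expectation (\<lambda>w. F \<sigma> (?it \<sigma> w))"
      using P.exists_large_expectation[OF fin\<Omega> card\<Omega> Bad integrable F_nonneg \<open>0 \<le> \<eta>\<close> large]
      by blast
    obtain z where z: "z \<in> Rd d" "(norm z)\<^sup>2 = real (card {..<K} * N) * a\<^sup>2" "F \<sigma> z = 0"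
      unfolding F_def
      by (rule flat_point[of "{..<K}" "scatter \<sigma>" N d \<tau> a "Lb / 4 / real K"])
        (use \<sigma> \<tau> inj img in auto)
    have "z \<in> ?X" using z a2 by (simp add: unit_ball_def)
    moreover have "Lb / (512 * real K * (real s)\<^sup>2) \<le> expected_value A_stoch d K Lb Lf x0 (fs \<sigma>) s"
      using \<sigma>(2) by (simp add: expected_value_def avg \<eta>_def)
    ultimately show "\<exists>fs z.
      (\<forall>i<K. fs i \<in> F11 d ?X Lb) \<and> avg K fs \<in> F11 d ?X Lf \<and>
      z \<in> ?X \<and> avg K fs z = 0 \<and> (\<forall>x. 0 \<le> avg K fs x) \<and>
      0 < avg K fs (full_iterate A_full d Lf x0 (avg K fs) s) \<and>
      Lb / (512 * real K * (real s)\<^sup>2) \<le> expected_value A_stoch d K Lb Lf x0 fs s"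
      using fs_F11 F_F11 F_nonneg full_pos z(3) \<sigma>(1)
      by (intro exI[of _ "fs \<sigma>"] exI[of _ z]) (simp add: avg)
  qed
qed

theorem theorem4p3:
  fixes A_full :: full_method and A_stoch :: "'w stoch_method"
  assumes "optimal_full A_full" and "optimal_stoch A_stoch"
  shows "\<exists>c0>0. \<forall>s\<ge>1. \<forall>K\<ge>1. \<forall>Lb>0. \<forall>Lf>0. Lb \<le> real K * Lf \<longrightarrow>
    (\<forall>\<^sub>F d in sequentially. \<forall>x0\<in>unit_ball d.
      \<exists>fs :: nat \<Rightarrow> vec \<Rightarrow> real.
        (\<forall>i<K. fs i \<in> F11 d (unit_ball d) Lb) \<and>
        avg K fs \<in> F11 d (unit_ball d) Lf \<and>
        (expected_value A_stoch d K Lb Lf x0 fs s - min_value (unit_ball d) (avg K fs))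
          / (avg K fs (full_iterate A_full d Lf x0 (avg K fs) s)
               - min_value (unit_ball d) (avg K fs))
        \<ge> c0 * Lb / (real K * Lf))"
proof -
  obtain C1 where C1: "0 < C1" and rate: "\<And>d Lf f x0 xs s. 0 < Lf \<Longrightarrow> f \<in> F11 d (unit_ball d) Lf \<Longrightarrow>
      x0 \<in> unit_ball d \<Longrightarrow> is_arg_min f (\<lambda>x. x \<in> unit_ball d) xs \<Longrightarrow> 1 \<le> s \<Longrightarrow>
      f (full_iterate A_full d Lf x0 f s) - min_value (unit_ball d) f
        \<le> C1 * Lf * (norm (x0 - xs))\<^sup>2 / (real s)\<^sup>2"
    using assms(1) unfolding optimal_full_def by blast
  have methods: "deterministic_gradient_method A_full" "stochastic_gradient_method A_stoch"
    using assms by (auto simp: optimal_full_def optimal_stoch_def)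
  show ?thesis
  \<comment> \<open>The lower bound has the constant \<open>1 / 512\<close> and the upper bound
    \<open>4 * C1\<close>, the 4 being the squared diameter of the ball; their powers of
    \<open>s\<close> cancel.\<close>
  proof (intro exI[of _ "1 / (2048 * C1)"] conjI allI impI)
    show "0 < 1 / (2048 * C1)" using C1 by simp
    fix s K :: nat and Lb Lf :: real
    assume *: "1 \<le> s" "1 \<le> K" "0 < Lb" "0 < Lf" "Lb \<le> real K * Lf"
    show "\<forall>\<^sub>F d in sequentially. \<forall>x0\<in>unit_ball d.
      \<exists>fs :: nat \<Rightarrow> vec \<Rightarrow> real.
        (\<forall>i<K. fs i \<in> F11 d (unit_ball d) Lb) \<and>
        avg K fs \<in> F11 d (unit_ball d) Lf \<and>
        (expected_value A_stoch d K Lb Lf x0 fs s - min_value (unit_ball d) (avg K fs))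
          / (avg K fs (full_iterate A_full d Lf x0 (avg K fs) s)
               - min_value (unit_ball d) (avg K fs))
        \<ge> 1 / (2048 * C1) * Lb / (real K * Lf)"
      using hard_instance[OF methods *]
    proof (rule eventually_mono, intro ballI)
      fix d x0
      assume hard: "\<forall>x0\<in>unit_ball d. \<exists>fs z.
        (\<forall>i<K. fs i \<in> F11 d (unit_ball d) Lb) \<and> avg K fs \<in> F11 d (unit_ball d) Lf \<and>
        z \<in> unit_ball d \<and> avg K fs z = 0 \<and> (\<forall>x. 0 \<le> avg K fs x) \<and>
        0 < avg K fs (full_iterate A_full d Lf x0 (avg K fs) s) \<and>
        Lb / (512 * real K * (real s)\<^sup>2) \<le> expected_value A_stoch d K Lb Lf x0 fs s"
      assume x0: "x0 \<in> unit_ball d"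
      obtain fs z where fs: "\<forall>i<K. fs i \<in> F11 d (unit_ball d) Lb" "avg K fs \<in> F11 d (unit_ball d) Lf"
        and z: "z \<in> unit_ball d" "avg K fs z = 0" "\<And>x. 0 \<le> avg K fs x"
        and pos: "0 < avg K fs (full_iterate A_full d Lf x0 (avg K fs) s)"
        and low: "Lb / (512 * real K * (real s)\<^sup>2) \<le> expected_value A_stoch d K Lb Lf x0 fs s"
        using hard x0 by blast
      let ?e = "expected_value A_stoch d K Lb Lf x0 fs s"
        and ?f = "avg K fs (full_iterate A_full d Lf x0 (avg K fs) s)"
      note min = min_value_eq_0[where f = "avg K fs", OF z]
      have "norm (x0 - z) \<le> 2"
        using norm_triangle_ineq4[of x0 z] norm_unit_ball[OF x0] norm_unit_ball[OF z(1)] by linarith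
      then have "(norm (x0 - z))\<^sup>2 \<le> 2\<^sup>2" by (intro power_mono) auto
      then have "C1 * Lf * (norm (x0 - z))\<^sup>2 / (real s)\<^sup>2 \<le> C1 * Lf * 4 / (real s)\<^sup>2"
        using C1 * by (intro divide_right_mono mult_left_mono) auto
      then have up: "?f \<le> C1 * Lf * 4 / (real s)\<^sup>2"
        using rate[OF *(4) fs(2) x0 min(2) *(1)] min(1) by linarith
      have "1 / (2048 * C1) * Lb / (real K * Lf)
          = (Lb / (512 * real K * (real s)\<^sup>2)) / (C1 * Lf * 4 / (real s)\<^sup>2)"
        using * C1 by (simp add: field_simps)
      also have "\<dots> \<le> ?e / ?f"
        using low up pos * by (intro frac_le) (auto intro: order_trans[rotated])
      finally have "1 / (2048 * C1) * Lb / (real K * Lf) \<le> (?e - min_value (unit_ball d) (avg K fs))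
          / (?f - min_value (unit_ball d) (avg K fs))"
        using min(1) by simp
      with fs show "\<exists>fs :: nat \<Rightarrow> vec \<Rightarrow> real.
        (\<forall>i<K. fs i \<in> F11 d (unit_ball d) Lb) \<and>
        avg K fs \<in> F11 d (unit_ball d) Lf \<and>
        (expected_value A_stoch d K Lb Lf x0 fs s - min_value (unit_ball d) (avg K fs))
          / (avg K fs (full_iterate A_full d Lf x0 (avg K fs) s)
               - min_value (unit_ball d) (avg K fs))
        \<ge> 1 / (2048 * C1) * Lb / (real K * Lf)"
        by blast
    qed
  qed
qed

end
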